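(* Let $\phi\in U$ and $\hat{\phi}\in C$ be given and consider the map $v=v^{\phi,\hat{\phi}}:(-\infty,t_\phi)\to\mathbb{R}^n$ defined by $$v(t)=(D\Sigma_t(\phi)\hat{\phi})(0)\ \text{ for }\ 0\le t<t_{\phi},\qquad v(t)=\hat{\phi}(t)\ \text{ for }\ t<0.$$ For every $t\in[0,t_{\phi})$, $$v_t=D\Sigma_t(\phi)\hat{\phi}\in C.$$ In particular, $v_0=\hat{\phi}$. The map $v$ is continuous, the restriction of $v$ to the interval $[0,t_{\phi})$ is differentiable, and $$v'(t)=Df(x^{\phi}_t)v_t\quad\text{for every}\quad t\in[0,t_{\phi}),$$ with the right derivative at $t=0$.
   Context: Let $n\in\mathbb{N}$ and let $C=C((-\infty,0],\mathbb{R}^n)$ be the Fréchet space of continuous maps $(-\infty,0]\to\mathbb{R}^n$ with the topology of locally uniform convergence (seminorms $|\phi|_j=\max_{-j\le t\le0}|\phi(t)|$, $j\in\mathbb{N}$). Let $U\subset C$ be open and let $f:U\to\mathbb{R}^n$ be $C^1_{\ast}$-smooth, where $\ast$ is either $MB$ or $F$ (the result holds in each case). Smoothness: Let $V,W$ be topological vector spaces, $O\subset V$ open, $g:O\to W$ continuous, $Dg(u)v=\lim_{0\neq t\to0}\frac1t(g(u+tv)-g(u))$. The map $g$ is $C^1_{MB}$-smooth if all directional derivatives $Dg(u)v$, $u\in O,v\in V$, exist and $O\times V\ni(u,v)\mapsto Dg(u)v\in W$ is continuous. It is $C^1_F$-smooth if all directional derivatives exist, each $Dg(u):V\to W$ is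 linear and continuous, and $O\ni u\mapsto Dg(u)\in L_c(V,W)$ is continuous with respect to the topology of uniform convergence on bounded sets on the space $L_c(V,W)$ of continuous linear maps. Segments: $x_t(s)=x(t+s)$ for $s\le0$. For an interval $I\subset\mathbb{R}$ a solution of $x'(t)=f(x_t)$ on $I$ is a continuous map $x:(-\infty,0]+I\to\mathbb{R}^n$ such that $x_t\in U$ for all $t\in I$, and $x|_I$ is differentiable and satisfies $x'(t)=f(x_t)$ for all $t\in I$ (one-sided derivatives at endpoints belonging to $I$). For $\phi\in U$ set $t_{\phi}=\sup\{t>0:\text{there is a solution of }x'(t)=f(x_t)\text{ on }[0,t]\text{ with }x_0=\phi\}\le\infty$; one has $t_\phi>0$, and $x^{\phi}:(-\infty,t_\phi)\to\mathbb{R}^n$ denotes the maximal solution on $[0,t_{\phi})$ with $x^{\phi}_0=\phi$. Set $\Omega=\{(t,\phi)\in[0,\infty)\times U:t<t_{\phi}\}$, $\Omega_t=\{\phi\in U:(t,\phi)\in\Omega\}$ (an open set), and $\Sigma_t:\Omega_t\to U$, $\Sigma_t(\phi)=x^{\phi}_t$; the maps $\Sigma_t$ are $C^1_\ast$-smooth with derivatives $D\Sigma_t(\phi):C\to C$. *)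

theory Defs
  imports "HOL-Analysis.Analysis"
begin

section \<open>Directional derivatives and smoothness\<close>

text \<open>
  The notions below are meant for Hausdorff topological vector spaces.  The arguments are total
  functions; on an open set \<open>X\<close>, the limits at \<open>0\<close> only see the restriction of \<open>g\<close> to \<open>X\<close>.
\<close>

definition has_dir_deriv ::
    "('v::{real_vector,topological_space} \<Rightarrow> 'w::{real_vector,t2_space}) \<Rightarrow> 'v \<Rightarrow> 'v \<Rightarrow> 'w \<Rightarrow> bool"
  where "has_dir_deriv g u v d \<longleftrightarrow> ((\<lambda>t::real. (1/t) *\<^sub>R (g (u + t *\<^sub>R v) - g u)) \<longlongrightarrow> d) (at 0)"

definition dir_differentiable ::
    "('v::{real_vector,topological_space} \<Rightarrow> 'w::{real_vector,t2_space}) \<Rightarrow> 'v \<Rightarrow> 'v \<Rightarrow> bool"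
  where "dir_differentiable g u v \<longleftrightarrow> (\<exists>d. has_dir_deriv g u v d)"

definition dir_deriv ::
    "('v::{real_vector,topological_space} \<Rightarrow> 'w::{real_vector,t2_space}) \<Rightarrow> 'v \<Rightarrow> 'v \<Rightarrow> 'w"
  where "dir_deriv g u v = Lim (at (0::real)) (\<lambda>t. (1/t) *\<^sub>R (g (u + t *\<^sub>R v) - g u))"

definition C1_MB ::
    "'v::{real_vector,topological_space} set \<Rightarrow> ('v \<Rightarrow> 'w::{real_vector,t2_space}) \<Rightarrow> bool"
  where "C1_MB X g \<longleftrightarrow> open X \<and> continuous_on X g \<and>
    (\<forall>u\<in>X. \<forall>v. dir_differentiable g u v) \<and>
    continuous_on (X \<times> UNIV) (\<lambda>(u, v). dir_deriv g u v)"

text \<open>Von Neumann boundedness; the constant \<open>bounded\<close> of the library refers to a metric.\<close>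

definition tvs_bounded :: "'v::{real_vector,topological_space} set \<Rightarrow> bool"
  where "tvs_bounded B \<longleftrightarrow>
    (\<forall>N. open N \<and> 0 \<in> N \<longrightarrow> (\<exists>s>0. \<forall>r>s. B \<subseteq> (\<lambda>x. r *\<^sub>R x) ` N))"

definition Lc :: "('v::{real_vector,topological_space} \<Rightarrow> 'w::{real_vector,topological_space}) set"
  where "Lc = {T. linear T \<and> continuous_on UNIV T}"

text \<open>
  Uniform convergence on bounded sets: the sets
  \<open>{S \<in> Lc. \<forall>v\<in>B. S v - T v \<in> N}\<close>, with \<open>B\<close> bounded and \<open>N\<close> an open neighbourhood of \<open>0\<close>,
  form a base of neighbourhoods of \<open>T\<close>.
\<close>

definition Lc_open ::
    "('v::{real_vector,topological_space} \<Rightarrow> 'w::{real_vector,topological_space}) set \<Rightarrow> bool"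
  where "Lc_open A \<longleftrightarrow> A \<subseteq> Lc \<and>
    (\<forall>T\<in>A. \<exists>B N. tvs_bounded B \<and> open N \<and> 0 \<in> N \<and> {S\<in>Lc. \<forall>v\<in>B. S v - T v \<in> N} \<subseteq> A)"

definition Lc_topology ::
    "('v::{real_vector,topological_space} \<Rightarrow> 'w::{real_vector,topological_space}) topology"
  where "Lc_topology = topology Lc_open"

lemma tvs_bounded_Un: "tvs_bounded A \<Longrightarrow> tvs_bounded B \<Longrightarrow> tvs_bounded (A \<union> B)"
  unfolding tvs_bounded_def
proof (intro allI impI)
  fix N :: "'a set"
  assume A: "\<forall>N. open N \<and> 0 \<in> N \<longrightarrow> (\<exists>s>0. \<forall>r>s. A \<subseteq> (\<lambda>x. r *\<^sub>R x) ` N)"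
    and B: "\<forall>N. open N \<and> 0 \<in> N \<longrightarrow> (\<exists>s>0. \<forall>r>s. B \<subseteq> (\<lambda>x. r *\<^sub>R x) ` N)"
    and N: "open N \<and> 0 \<in> N"
  from A N obtain s where s: "s > 0" "\<forall>r>s. A \<subseteq> (\<lambda>x. r *\<^sub>R x) ` N" by blast
  from B N obtain s' where s': "s' > 0" "\<forall>r>s'. B \<subseteq> (\<lambda>x. r *\<^sub>R x) ` N" by blast
  show "\<exists>s>0. \<forall>r>s. A \<union> B \<subseteq> (\<lambda>x. r *\<^sub>R x) ` N"
    by (rule exI[of _ "max s s'"]) (use s s' in auto)
qed

lemma openin_Lc_topology: "openin Lc_topology = Lc_open"
proof -
  have "istopology (Lc_open :: ('a \<Rightarrow> 'b) set \<Rightarrow> bool)"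
    unfolding istopology_def
  proof (intro conjI allI impI)
    fix P Q :: "('a \<Rightarrow> 'b) set"
    assume P: "Lc_open P" and Q: "Lc_open Q"
    show "Lc_open (P \<inter> Q)"
      unfolding Lc_open_def
    proof (intro conjI ballI)
      show "P \<inter> Q \<subseteq> Lc" using P by (auto simp: Lc_open_def)
      fix T assume T: "T \<in> P \<inter> Q"
      obtain B N where 1: "tvs_bounded B" "open N" "0 \<in> N"
          "{S\<in>Lc. \<forall>v\<in>B. S v - T v \<in> N} \<subseteq> P"
        using P T unfolding Lc_open_def by blast
      obtain B' N' where 2: "tvs_bounded B'" "open N'" "0 \<in> N'"
          "{S\<in>Lc. \<forall>v\<in>B'. S v - T v \<in> N'} \<subseteq> Q"
        using Q T unfolding Lc_open_def by blast
      show "\<exists>B N. tvs_bounded B \<and> open N \<and> 0 \<in> N \<and>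
          {S\<in>Lc. \<forall>v\<in>B. S v - T v \<in> N} \<subseteq> P \<inter> Q"
        by (rule exI[of _ "B \<union> B'"], rule exI[of _ "N \<inter> N'"])
          (use 1 2 in \<open>auto intro: tvs_bounded_Un\<close>)
    qed
  next
    fix K :: "('a \<Rightarrow> 'b) set set"
    assume K: "\<forall>A\<in>K. Lc_open A"
    show "Lc_open (\<Union>K)"
      unfolding Lc_open_def
    proof (intro conjI ballI)
      show "\<Union>K \<subseteq> Lc" using K by (auto simp: Lc_open_def)
      fix T assume "T \<in> \<Union>K"
      then obtain A where A: "A \<in> K" "T \<in> A" by blast
      then obtain B N where "tvs_bounded B" "open N" "0 \<in> N"
          "{S\<in>Lc. \<forall>v\<in>B. S v - T v \<in> N} \<subseteq> A"
        using K unfolding Lc_open_def by meson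
      with A show "\<exists>B N. tvs_bounded B \<and> open N \<and> 0 \<in> N \<and>
          {S\<in>Lc. \<forall>v\<in>B. S v - T v \<in> N} \<subseteq> \<Union>K"
        by blast
    qed
  qed
  then show ?thesis
    unfolding Lc_topology_def by (rule topology_inverse')
qed

lemma topspace_Lc_topology: "topspace Lc_topology = Lc"
proof -
  have "Lc_open (Lc :: ('a \<Rightarrow> 'b) set)"
    unfolding Lc_open_def
    by (intro conjI ballI order_refl exI[of _ "{}"] exI[of _ UNIV]) (auto simp: tvs_bounded_def intro: exI[of _ 1])
  then have "openin Lc_topology (Lc :: ('a \<Rightarrow> 'b) set)"
    by (simp add: openin_Lc_topology)
  moreover have "topspace Lc_topology \<subseteq> (Lc :: ('a \<Rightarrow> 'b) set)"
    using openin_topspace[of "Lc_topology :: ('a \<Rightarrow> 'b) topology"]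
    by (simp add: openin_Lc_topology Lc_open_def)
  ultimately show ?thesis
    by (simp add: openin_subset subset_antisym)
qed

definition C1_F ::
    "'v::{real_vector,topological_space} set \<Rightarrow> ('v \<Rightarrow> 'w::{real_vector,t2_space}) \<Rightarrow> bool"
  where "C1_F X g \<longleftrightarrow> open X \<and> continuous_on X g \<and>
    (\<forall>u\<in>X. \<forall>v. dir_differentiable g u v) \<and>
    (\<forall>u\<in>X. dir_deriv g u \<in> Lc) \<and>
    continuous_map (top_of_set X) Lc_topology (dir_deriv g)"


section \<open>The Frechet space of histories\<close>

text \<open>
  A continuous map on \<open>{..0}\<close> is represented by its extension to the real line that is constant
  on \<open>{0..}\<close>; continuity of the extension is equivalent to continuity on \<open>{..0}\<close>.
\<close>

typedef (overloaded) 'n hist =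
  "{\<phi> :: real \<Rightarrow> real ^ 'n::finite. continuous_on UNIV \<phi> \<and> (\<forall>t>0. \<phi> t = \<phi> 0)}"
  morphisms hist_apply Abs_hist
  by (rule exI[of _ "\<lambda>_. 0"]) auto

setup_lifting type_definition_hist

lemma hist_eqI:
  assumes "\<And>t. t \<le> 0 \<Longrightarrow> hist_apply \<phi> t = hist_apply \<psi> t"
  shows "\<phi> = \<psi>"
proof -
  have "hist_apply \<phi> t = hist_apply \<psi> t" for t
  proof (cases "t \<le> 0")
    case False
    then have "hist_apply \<phi> t = hist_apply \<phi> 0" "hist_apply \<psi> t = hist_apply \<psi> 0"
      using hist_apply[of \<phi>] hist_apply[of \<psi>] by auto
    then show ?thesis using assms[of 0] by simp
  qed (rule assms)
  then show ?thesis
    by (intro hist_apply_inject[THEN iffD1] ext)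
qed

instantiation hist :: (finite) real_vector
begin

lift_definition zero_hist :: "'a hist" is "\<lambda>_. 0" by simp
lift_definition plus_hist :: "'a hist \<Rightarrow> 'a hist \<Rightarrow> 'a hist" is "\<lambda>\<phi> \<psi> t. \<phi> t + \<psi> t"
  by (auto intro: continuous_on_add)
lift_definition minus_hist :: "'a hist \<Rightarrow> 'a hist \<Rightarrow> 'a hist" is "\<lambda>\<phi> \<psi> t. \<phi> t - \<psi> t"
  by (auto intro: continuous_on_diff)
lift_definition uminus_hist :: "'a hist \<Rightarrow> 'a hist" is "\<lambda>\<phi> t. - \<phi> t"
  by (auto intro: continuous_on_minus)
lift_definition scaleR_hist :: "real \<Rightarrow> 'a hist \<Rightarrow> 'a hist" is "\<lambda>c \<phi> t. c *\<^sub>R \<phi> t"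
  by (auto intro: continuous_on_scaleR)

instance
  by standard (transfer; simp add: algebra_simps)+

end

definition hist_seminorm :: "nat \<Rightarrow> 'n::finite hist \<Rightarrow> real"
  where "hist_seminorm j \<phi> = (SUP t\<in>{- real j..0}. norm (hist_apply \<phi> t))"

lemma continuous_on_hist_apply: "continuous_on A (hist_apply \<phi>)"
  using hist_apply[of \<phi>] by (auto intro: continuous_on_subset)

lemma hist_seminorm_bdd: "bdd_above ((\<lambda>t. norm (hist_apply \<phi> t)) ` {- real j..0})"
  by (intro compact_imp_bounded[THEN bounded_imp_bdd_above] compact_continuous_image
      continuous_on_norm continuous_on_hist_apply) auto

lemma norm_le_hist_seminorm: "- real j \<le> t \<Longrightarrow> t \<le> 0 \<Longrightarrow> norm (hist_apply \<phi> t) \<le> hist_seminorm j \<phi>"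
  unfolding hist_seminorm_def by (intro cSUP_upper hist_seminorm_bdd) auto

lemma hist_seminorm_le:
  "(\<And>t. - real j \<le> t \<Longrightarrow> t \<le> 0 \<Longrightarrow> norm (hist_apply \<phi> t) \<le> c) \<Longrightarrow> hist_seminorm j \<phi> \<le> c"
  unfolding hist_seminorm_def by (intro cSUP_least) auto

lemma hist_seminorm_nonneg: "0 \<le> hist_seminorm j \<phi>"
  using norm_le_hist_seminorm[of j 0 \<phi>] norm_ge_zero[of "hist_apply \<phi> 0"] by linarith

lemma hist_seminorm_mono: "i \<le> j \<Longrightarrow> hist_seminorm i \<phi> \<le> hist_seminorm j \<phi>"
  by (intro hist_seminorm_le norm_le_hist_seminorm) auto

lemma hist_seminorm_zero [simp]: "hist_seminorm j 0 = 0"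
  by (intro antisym hist_seminorm_le hist_seminorm_nonneg) (auto simp: zero_hist.rep_eq)

lemma hist_seminorm_add: "hist_seminorm j (\<phi> + \<psi>) \<le> hist_seminorm j \<phi> + hist_seminorm j \<psi>"
  by (intro hist_seminorm_le)
    (auto simp: plus_hist.rep_eq intro!: norm_triangle_mono norm_le_hist_seminorm)

lemma hist_seminorm_minus [simp]: "hist_seminorm j (- \<phi>) = hist_seminorm j \<phi>"
  by (simp add: hist_seminorm_def uminus_hist.rep_eq)

lemma hist_seminorm_scaleR: "hist_seminorm j (c *\<^sub>R \<phi>) \<le> \<bar>c\<bar> * hist_seminorm j \<phi>"
  by (intro hist_seminorm_le)
    (auto simp: scaleR_hist.rep_eq intro!: mult_left_mono norm_le_hist_seminorm)

lemma hist_seminorm_commute: "hist_seminorm j (\<phi> - \<psi>) = hist_seminorm j (\<psi> - \<phi>)"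
  by (metis hist_seminorm_minus minus_diff_eq)

lemma hist_seminorm_triangle:
  "hist_seminorm j (\<phi> - \<eta>) \<le> hist_seminorm j (\<phi> - \<psi>) + hist_seminorm j (\<psi> - \<eta>)"
  using hist_seminorm_add[of j "\<phi> - \<psi>" "\<psi> - \<eta>"] by simp

text \<open>The seminorms increase with \<open>j\<close>, so balls of single seminorms form a base.\<close>

instantiation hist :: (finite) topological_space
begin

definition open_hist :: "'a hist set \<Rightarrow> bool"
  where "open_hist S \<longleftrightarrow> (\<forall>\<phi>\<in>S. \<exists>j. \<exists>e>0. {\<psi>. hist_seminorm j (\<psi> - \<phi>) < e} \<subseteq> S)"

instance
proof
  show "open (UNIV :: 'a hist set)"
    by (auto simp: open_hist_def intro: exI[of _ 1])
next
  fix S T :: "'a hist set"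
  assume S: "open S" and T: "open T"
  show "open (S \<inter> T)"
    unfolding open_hist_def
  proof
    fix \<phi> assume "\<phi> \<in> S \<inter> T"
    then obtain i d j e where *: "d > 0" "{\<psi>. hist_seminorm i (\<psi> - \<phi>) < d} \<subseteq> S"
        "e > 0" "{\<psi>. hist_seminorm j (\<psi> - \<phi>) < e} \<subseteq> T"
      using S T unfolding open_hist_def by blast
    have "{\<psi>. hist_seminorm (max i j) (\<psi> - \<phi>) < min d e} \<subseteq> S \<inter> T"
    proof
      fix \<psi> assume "\<psi> \<in> {\<psi>. hist_seminorm (max i j) (\<psi> - \<phi>) < min d e}"
      then have "hist_seminorm i (\<psi> - \<phi>) < d" "hist_seminorm j (\<psi> - \<phi>) < e"
        using hist_seminorm_mono[of i "max i j" "\<psi> - \<phi>"]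
          hist_seminorm_mono[of j "max i j" "\<psi> - \<phi>"] by auto
      with * show "\<psi> \<in> S \<inter> T" by auto
    qed
    with * show "\<exists>j. \<exists>e>0. {\<psi>. hist_seminorm j (\<psi> - \<phi>) < e} \<subseteq> S \<inter> T"
      by (intro exI[of _ "max i j"] exI[of _ "min d e"]) auto
  qed
next
  fix K :: "'a hist set set"
  assume K: "\<forall>S\<in>K. open S"
  show "open (\<Union>K)"
    unfolding open_hist_def
  proof
    fix \<phi> assume "\<phi> \<in> \<Union>K"
    then obtain S where S: "S \<in> K" "\<phi> \<in> S" by blast
    then obtain j e where "e > 0" "{\<psi>. hist_seminorm j (\<psi> - \<phi>) < e} \<subseteq> S"
      using K unfolding open_hist_def by blast
    with S show "\<exists>j. \<exists>e>0. {\<psi>. hist_seminorm j (\<psi> - \<phi>) < e} \<subseteq> \<Union>K" by blast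
  qed
qed

end

lemma open_hist_ball: "open {\<psi>. hist_seminorm j (\<psi> - \<phi>) < e}"
  unfolding open_hist_def
proof
  fix \<eta> assume "\<eta> \<in> {\<psi>. hist_seminorm j (\<psi> - \<phi>) < e}"
  then have "e - hist_seminorm j (\<eta> - \<phi>) > 0" by simp
  moreover have "{\<psi>. hist_seminorm j (\<psi> - \<eta>) < e - hist_seminorm j (\<eta> - \<phi>)}
      \<subseteq> {\<psi>. hist_seminorm j (\<psi> - \<phi>) < e}"
  proof
    fix \<psi> assume "\<psi> \<in> {\<psi>. hist_seminorm j (\<psi> - \<eta>) < e - hist_seminorm j (\<eta> - \<phi>)}"
    then show "\<psi> \<in> {\<psi>. hist_seminorm j (\<psi> - \<phi>) < e}"
      using hist_seminorm_triangle[of j \<psi> \<phi> \<eta>] by simp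
  qed
  ultimately show "\<exists>i. \<exists>d>0. {\<psi>. hist_seminorm i (\<psi> - \<eta>) < d} \<subseteq> {\<psi>. hist_seminorm j (\<psi> - \<phi>) < e}"
    by blast
qed

lemma tendsto_hist_iff:
  "(g \<longlongrightarrow> l) F \<longleftrightarrow> (\<forall>j. ((\<lambda>x. hist_seminorm j (g x - l)) \<longlongrightarrow> 0) F)"
proof
  assume g: "(g \<longlongrightarrow> l) F"
  show "\<forall>j. ((\<lambda>x. hist_seminorm j (g x - l)) \<longlongrightarrow> 0) F"
  proof
    fix j
    show "((\<lambda>x. hist_seminorm j (g x - l)) \<longlongrightarrow> 0) F"
    proof (rule tendstoI)
      fix e :: real assume "e > 0"
      then have "eventually (\<lambda>x. g x \<in> {\<psi>. hist_seminorm j (\<psi> - l) < e}) F"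
        by (intro topological_tendstoD[OF g] open_hist_ball) auto
      then show "eventually (\<lambda>x. dist (hist_seminorm j (g x - l)) 0 < e) F"
        by eventually_elim (simp add: hist_seminorm_nonneg)
    qed
  qed
next
  assume *: "\<forall>j. ((\<lambda>x. hist_seminorm j (g x - l)) \<longlongrightarrow> 0) F"
  show "(g \<longlongrightarrow> l) F"
  proof (rule topological_tendstoI)
    fix S assume "open S" "l \<in> S"
    then obtain j e where je: "e > 0" "{\<psi>. hist_seminorm j (\<psi> - l) < e} \<subseteq> S"
      unfolding open_hist_def by blast
    from tendstoD[OF spec[OF *] je(1)] have "eventually (\<lambda>x. dist (hist_seminorm j (g x - l)) 0 < e) F"
      .
    then show "eventually (\<lambda>x. g x \<in> S) F"
      by eventually_elim (use je(2) in \<open>auto simp: hist_seminorm_nonneg\<close>)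
  qed
qed

lemma tendsto_hist_bound:
  assumes "\<And>j x. hist_seminorm j (g x - l) \<le> b j x" "\<And>j. (b j \<longlongrightarrow> 0) F"
  shows "(g \<longlongrightarrow> l) F"
proof -
  have "((\<lambda>x. hist_seminorm j (g x - l)) \<longlongrightarrow> 0) F" for j
    by (rule Lim_null_comparison[OF always_eventually assms(2)[of j]])
      (simp add: assms(1) hist_seminorm_nonneg)
  then show ?thesis unfolding tendsto_hist_iff by blast
qed

lemma tendsto_histD: "(g \<longlongrightarrow> l) F \<Longrightarrow> ((\<lambda>x. hist_seminorm j (g x - l)) \<longlongrightarrow> 0) F"
  unfolding tendsto_hist_iff by blast

instance hist :: (finite) t2_space
proof
  fix \<phi> \<psi> :: "'a hist"
  assume "\<phi> \<noteq> \<psi>"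
  then obtain t where t: "t \<le> 0" "hist_apply \<phi> t \<noteq> hist_apply \<psi> t"
    using hist_eqI by blast
  obtain j :: nat where j: "- t \<le> real j" using real_arch_simple by blast
  define e where "e = hist_seminorm j (\<phi> - \<psi>) / 2"
  have "norm (hist_apply (\<phi> - \<psi>) t) > 0"
    using t by (simp add: minus_hist.rep_eq)
  also have "norm (hist_apply (\<phi> - \<psi>) t) \<le> hist_seminorm j (\<phi> - \<psi>)"
    using t j by (intro norm_le_hist_seminorm) auto
  finally have e: "e > 0" by (simp add: e_def)
  let ?A = "{\<eta>. hist_seminorm j (\<eta> - \<phi>) < e}" and ?B = "{\<eta>. hist_seminorm j (\<eta> - \<psi>) < e}"
  have "\<eta> \<notin> ?B" if "\<eta> \<in> ?A" for \<eta>
    using that hist_seminorm_triangle[of j \<phi> \<psi> \<eta>] hist_seminorm_commute[of j \<eta> \<phi>]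
    unfolding e_def by simp
  then have "?A \<inter> ?B = {}" by blast
  moreover have "\<phi> \<in> ?A" "\<psi> \<in> ?B" using e by auto
  ultimately show "\<exists>A B. open A \<and> open B \<and> \<phi> \<in> A \<and> \<psi> \<in> B \<and> A \<inter> B = {}"
    by (intro exI[of _ ?A] exI[of _ ?B] conjI open_hist_ball)
qed

instance hist :: (finite) topological_ab_group_add
proof
  fix a b :: "'a hist"
  have F: "((\<lambda>x. fst x) \<longlongrightarrow> a) (nhds a \<times>\<^sub>F nhds b)" "((\<lambda>x. snd x) \<longlongrightarrow> b) (nhds a \<times>\<^sub>F nhds b)"
    by (rule filterlim_fst filterlim_snd)+
  show "((\<lambda>x. fst x + snd x) \<longlongrightarrow> a + b) (nhds a \<times>\<^sub>F nhds b)"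
  proof (rule tendsto_hist_bound)
    fix j and x :: "'a hist \<times> 'a hist"
    have "fst x + snd x - (a + b) = (fst x - a) + (snd x - b)" by simp
    then show "hist_seminorm j (fst x + snd x - (a + b))
        \<le> hist_seminorm j (fst x - a) + hist_seminorm j (snd x - b)"
      by (simp only: hist_seminorm_add)
  next
    fix j
    show "((\<lambda>x. hist_seminorm j (fst x - a) + hist_seminorm j (snd x - b)) \<longlongrightarrow> 0) (nhds a \<times>\<^sub>F nhds b)"
      using tendsto_add[OF tendsto_histD[OF F(1), of j] tendsto_histD[OF F(2), of j]] by simp
  qed
  have I: "((\<lambda>x. x) \<longlongrightarrow> a) (nhds a)" by (rule filterlim_ident)
  show "(uminus \<longlongrightarrow> - a) (nhds a)"
  proof (rule tendsto_hist_bound)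
    fix j and x :: "'a hist"
    have "- x - - a = - (x - a)" by simp
    then show "hist_seminorm j (- x - - a) \<le> hist_seminorm j (x - a)"
      by (simp only: hist_seminorm_minus order_refl)
  qed (rule tendsto_histD[OF I])
qed

lemma tendsto_scaleR_hist:
  fixes g :: "'b \<Rightarrow> 'n::finite hist"
  assumes c: "(c \<longlongrightarrow> c0) F" and g: "(g \<longlongrightarrow> l) F"
  shows "((\<lambda>x. c x *\<^sub>R g x) \<longlongrightarrow> c0 *\<^sub>R l) F"
proof (rule tendsto_hist_bound)
  fix j x
  have *: "c x *\<^sub>R g x - c0 *\<^sub>R l = c x *\<^sub>R (g x - l) + (c x - c0) *\<^sub>R l"
    by (simp add: scaleR_diff_left scaleR_diff_right)
  show "hist_seminorm j (c x *\<^sub>R g x - c0 *\<^sub>R l)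
      \<le> \<bar>c x\<bar> * hist_seminorm j (g x - l) + \<bar>c x - c0\<bar> * hist_seminorm j l"
    using hist_seminorm_add[of j "c x *\<^sub>R (g x - l)" "(c x - c0) *\<^sub>R l"]
      hist_seminorm_scaleR[of j "c x" "g x - l"] hist_seminorm_scaleR[of j "c x - c0" l]
    unfolding * by linarith
next
  fix j
  have "((\<lambda>x. \<bar>c x\<bar> * hist_seminorm j (g x - l) + \<bar>c x - c0\<bar> * hist_seminorm j l)
      \<longlongrightarrow> \<bar>c0\<bar> * 0 + \<bar>c0 - c0\<bar> * hist_seminorm j l) F"
    by (intro tendsto_intros c tendsto_histD[OF g])
  then show "((\<lambda>x. \<bar>c x\<bar> * hist_seminorm j (g x - l) + \<bar>c x - c0\<bar> * hist_seminorm j l) \<longlongrightarrow> 0) F"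
    by simp
qed


section \<open>Solutions and the solution semiflow\<close>

text \<open>
  Only meaningful if \<open>x\<close> is continuous on \<open>{..t}\<close>; see \<open>hist_apply_seg\<close> below.
\<close>

definition seg :: "(real \<Rightarrow> real ^ 'n::finite) \<Rightarrow> real \<Rightarrow> 'n hist"
  where "seg x t = Abs_hist (\<lambda>s. x (t + min s 0))"

lemma hist_apply_seg:
  assumes "continuous_on {..t} x" "s \<le> 0"
  shows "hist_apply (seg x t) s = x (t + s)"
proof -
  have "continuous_on UNIV (\<lambda>s. x (t + min s 0))"
    by (rule continuous_on_compose2[OF assms(1)]) (auto intro!: continuous_intros)
  then have "hist_apply (seg x t) = (\<lambda>s. x (t + min s 0))"
    unfolding seg_def by (intro Abs_hist_inverse) auto
  with assms(2) show ?thesis by simp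
qed

text \<open>
  A solution on \<open>I\<close> is a map on \<open>{..0} + I\<close>; values of \<open>x\<close> elsewhere are irrelevant.
\<close>

definition is_solution ::
    "('n::finite hist \<Rightarrow> real ^ 'n) \<Rightarrow> 'n hist set \<Rightarrow> real set \<Rightarrow> (real \<Rightarrow> real ^ 'n) \<Rightarrow> bool"
  where "is_solution f U I x \<longleftrightarrow>
    continuous_on {s + t |s t. s \<le> 0 \<and> t \<in> I} x \<and>
    (\<forall>t\<in>I. seg x t \<in> U) \<and>
    (\<forall>t\<in>I. (x has_vector_derivative f (seg x t)) (at t within I))"

definition exit_time ::
    "('n::finite hist \<Rightarrow> real ^ 'n) \<Rightarrow> 'n hist set \<Rightarrow> 'n hist \<Rightarrow> ereal"
  where "exit_time f U \<phi> =
    Sup {ereal t |t. t > 0 \<and> (\<exists>x. is_solution f U {0..t} x \<and> seg x 0 = \<phi>)}"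

text \<open>For smooth \<open>f\<close> a solution is unique on its domain; the choice only affects times beyond it.\<close>

definition max_solution ::
    "('n::finite hist \<Rightarrow> real ^ 'n) \<Rightarrow> 'n hist set \<Rightarrow> 'n hist \<Rightarrow> real \<Rightarrow> real ^ 'n"
  where "max_solution f U \<phi> =
    (SOME x. is_solution f U {t. 0 \<le> t \<and> ereal t < exit_time f U \<phi>} x \<and> seg x 0 = \<phi>)"

text \<open>\<open>semiflow f U t\<close> is the map \<open>\<Sigma>\<^sub>t\<close>; its domain is
  \<open>\<Omega>\<^sub>t = {\<phi> \<in> U. 0 \<le> t \<and> ereal t < exit_time f U \<phi>}\<close>.\<close>

definition semiflow ::
    "('n::finite hist \<Rightarrow> real ^ 'n) \<Rightarrow> 'n hist set \<Rightarrow> real \<Rightarrow> 'n hist \<Rightarrow> 'n hist"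
  where "semiflow f U t \<phi> = seg (max_solution f U \<phi>) t"

end

(*
  Continuity of the derivative at (c, 0) and homogeneity bound Df near c by a multiple of a single
  seminorm; so near a compact piece of an orbit f is Lipschitz with respect to one seminorm |.|_k,
  that is, it sees only a bounded delay there.  Let V be the solution of the linear variational
  equation along x on [0,T] with initial history phi'.  For small h the solution y with initial
  history phi + h phi' is obtained by clipping the deviation from x, which makes the right-hand side
  globally Lipschitz, and Gronwall's estimate shows that the clipping has no effect.  A second
  Gronwall estimate gives y - x - h V = o(h) uniformly on (-oo,T].  Hence V_t is the directional
  derivative of the semiflow, v = V before time T, and the assertions on v are those on V.
*)
theory Submission
  imports Defs
begin

section \<open>Segments and delayed Gronwall estimates\<close>

text \<open>The space of histories carries no norm, and \<open>C1_MB\<close> gives continuity of the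
  derivative jointly in base point and direction, not in an operator norm, so the usual Banach space
  arguments do not apply directly. The bounded delay is the way out: along a compact orbit piece
  every estimate becomes one about values in \<open>real ^ 'n\<close> on a bounded window, where a
  scalar comparison works. A bound found with the single index \<open>k\<close> still controls all
  seminorms of the target. The deviation \<open>y - x - h V\<close> vanishes on the past, so a
  pointwise bound on \<open>{0..T}\<close> is a bound on \<open>{..T}\<close>, whatever the length
  of the window. Clipping is used because \<open>f\<close> is defined and Lipschitz only near the
  orbit; it yields the perturbed solution on all of \<open>{0..T}\<close> at once, without a
  continuation argument. Only MB smoothness is treated, since on this metrizable space
  \<open>C1_F\<close> implies \<open>C1_MB\<close>.\<close>

lemma seg_eqI:
  assumes "\<And>s. s \<le> t \<Longrightarrow> x s = y s"
  shows "seg x t = seg y t"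
  unfolding seg_def using assms by (intro arg_cong[of _ _ Abs_hist] ext) auto

lemma seg_hist_apply:
  assumes "\<And>s. s \<le> 0 \<Longrightarrow> x s = hist_apply \<psi> s"
  shows "seg x 0 = \<psi>"
proof -
  have "continuous_on {..0} x"
    using continuous_on_hist_apply[of "{..0}" \<psi>] assms
    by (metis atMost_iff continuous_on_cong)
  then show ?thesis
    using assms by (intro hist_eqI) (simp add: hist_apply_seg)
qed

lemma hist_seminorm_seg_diff_le:
  assumes "continuous_on {..t} x" "continuous_on {..t} y"
    and "\<And>s. t - real j \<le> s \<Longrightarrow> s \<le> t \<Longrightarrow> norm (x s - y s) \<le> c"
  shows "hist_seminorm j (seg x t - seg y t) \<le> c"
  by (rule hist_seminorm_le) (use assms in \<open>auto simp: minus_hist.rep_eq hist_apply_seg\<close>)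

lemma continuous_on_seg:
  assumes "continuous_on {..T} x"
  shows "continuous_on {..T} (seg x)"
  unfolding continuous_on_def
proof (intro ballI, unfold tendsto_hist_iff, intro allI tendstoI)
  fix t j and e :: real assume t: "t \<in> {..T}" and e: "e > 0"
  have cx: "continuous_on {..r} x" if "r \<le> T" for r
    by (rule continuous_on_subset[OF assms]) (use that in auto)
  \<comment> \<open>The \<open>j\<close>-th seminorm at time \<open>r\<close> reads \<open>x\<close>
    back to \<open>r - j\<close>; the extra 1 leaves room for \<open>r\<close> within distance 1 of
    \<open>t\<close>.\<close>
  have "uniformly_continuous_on {t - real j - 1..T} x"
    by (intro compact_uniformly_continuous continuous_on_subset[OF assms]) auto
  then obtain d where d: "d > 0"
    "\<And>a b. a \<in> {t - real j - 1..T} \<Longrightarrow> b \<in> {t - real j - 1..T} \<Longrightarrow> dist b a < d \<Longrightarrow> dist (x b) (x a) < e/2"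
    unfolding uniformly_continuous_on_def using e by (metis half_gt_zero)
  have "\<forall>\<^sub>F r in at t within {..T}. dist r t < min d 1 \<and> r \<in> {..T}"
    using d(1) unfolding eventually_at by (auto intro!: exI[of _ "min d 1"])
  then show "\<forall>\<^sub>F r in at t within {..T}. dist (hist_seminorm j (seg x r - seg x t)) 0 < e"
  proof eventually_elim
    case (elim r)
    have "hist_seminorm j (seg x r - seg x t) \<le> e/2"
    proof (rule hist_seminorm_le)
      fix s assume s: "- real j \<le> s" "s \<le> 0"
      have "dist (x (r + s)) (x (t + s)) < e/2"
        by (rule d(2)) (use elim t s in \<open>auto simp: dist_real_def\<close>)
      then show "norm (hist_apply (seg x r - seg x t) s) \<le> e/2"
        using s elim t cx by (simp add: minus_hist.rep_eq hist_apply_seg dist_norm)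
    qed
    then show ?case using e by (simp add: hist_seminorm_nonneg)
  qed
qed

text \<open>Gronwall's estimate for delay equations: integrating up to the first time at which the bound
  fails gives a contradiction.  The hypothesis on \<open>d'\<close> is only used while \<open>d\<close> stays below \<open>\<delta>\<close>, which
  makes the lemma applicable to right-hand sides that are Lipschitz only locally.\<close>

lemma norm_less_exp_delay:
  fixes d :: "real \<Rightarrow> 'a::real_normed_vector" and j :: real
  assumes d: "continuous_on {0..T} d"
    "\<And>t. t \<in> {0..T} \<Longrightarrow> (d has_vector_derivative d' t) (at t within {0..T})"
    and init: "\<And>s. - j \<le> s \<Longrightarrow> s \<le> 0 \<Longrightarrow> norm (d s) < \<eta>"
    and bound: "\<And>t M. t \<in> {0..T} \<Longrightarrow> M \<le> \<delta> \<Longrightarrow>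
      (\<And>s. t - j \<le> s \<Longrightarrow> s \<le> t \<Longrightarrow> norm (d s) \<le> M) \<Longrightarrow> norm (d' t) \<le> L * M + \<epsilon>"
    and c: "0 \<le> L" "0 \<le> j" "\<epsilon> \<le> \<eta>" "\<eta> * exp ((L + 1) * T) \<le> \<delta>"
    and t: "t \<in> {0..T}"
  shows "norm (d t) < \<eta> * exp ((L + 1) * t)"
proof (rule ccontr)
  define B where "B t = \<eta> * exp ((L + 1) * t)" for t
  have \<eta>: "\<eta> > 0" using init[of 0] c norm_ge_zero[of "d 0"] by linarith
  have Bmono: "B r \<le> B s" if "r \<le> s" for r s
    unfolding B_def using \<eta> c that by (intro mult_left_mono) auto
  assume "\<not> norm (d t) < \<eta> * exp ((L + 1) * t)"
  then have nt: "B t \<le> norm (d t)" by (simp add: B_def)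
  define S where "S = {r \<in> {0..T}. B r \<le> norm (d r)}"
  have "closed S" unfolding S_def
    by (intro continuous_on_closed_Collect_le) (auto simp: B_def intro!: continuous_intros d)
  moreover have "bounded S" by (rule bounded_subset[of "{0..T}"]) (auto simp: S_def)
  ultimately have "compact S" by (simp add: compact_eq_bounded_closed)
  then obtain u where u: "u \<in> S" "\<And>s. s \<in> S \<Longrightarrow> u \<le> s"
    using compact_attains_inf[of S] nt t unfolding S_def by blast
  have u0: "u \<in> {0..T}" "B u \<le> norm (d u)" using u(1) by (auto simp: S_def)
  have B0: "B 0 = \<eta>" by (simp add: B_def)
  have "u \<noteq> 0" using u0 init[of 0] c B0 by auto
  then have upos: "u > 0" using u0 by auto
  have before: "norm (d s) \<le> B r" if "- j \<le> s" "s \<le> r" "0 \<le> r" "r < u" for s r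
  proof (cases "s \<le> 0")
    case True
    then show ?thesis using init[of s] that Bmono[of 0 r] B0 by linarith
  next
    case False
    then have "norm (d s) \<le> B s" using u(2)[of s] that u0 by (force simp: S_def)
    with Bmono[of s r] that show ?thesis by linarith
  qed
  have "norm (d u - d 0) \<le> B u - B 0"
  proof (rule differentiable_bound_general[OF upos, where f' = d' and \<phi>' = "\<lambda>s. (L + 1) * B s"])
    show "continuous_on {0..u} d" by (rule continuous_on_subset[OF d(1)]) (use u0 in auto)
    show "continuous_on {0..u} B" unfolding B_def by (intro continuous_intros)
    fix r assume r: "0 < r" "r < u"
    have "(d has_vector_derivative d' r) (at r within {0..T})" using d(2) r u0 by auto
    then show "(d has_vector_derivative d' r) (at r)"
      using r u0 at_within_Icc_at[of 0 r T] by simp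
    show "(B has_vector_derivative (L + 1) * B r) (at r)"
      unfolding has_real_derivative_iff_has_vector_derivative[symmetric] B_def
      by (auto intro!: derivative_eq_intros)
    have "norm (d' r) \<le> L * B r + \<epsilon>"
    proof (rule bound)
      show "r \<in> {0..T}" using r u0 by auto
      show "B r \<le> \<delta>" using Bmono[of r T] r u0 c by (auto simp: B_def)
      show "norm (d s) \<le> B r" if "r - j \<le> s" "s \<le> r" for s
        using before[of s r] that r by auto
    qed
    \<comment> \<open>The 1 in the rate \<open>L + 1\<close> absorbs the inhomogeneity: \<epsilon>
      \<le> \<eta> = \<open>B 0\<close> \<le> \<open>B r\<close>.\<close>
    also have "\<dots> \<le> (L + 1) * B r" using Bmono[of 0 r] B0 r c by (auto simp: algebra_simps)
    finally show "norm (d' r) \<le> (L + 1) * B r" .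
  qed
  \<comment> \<open>At 0 the deviation is strictly below \<open>B 0\<close>, and this gap persists
    up to \<open>u\<close>, against the choice of \<open>u\<close>.\<close>
  then have "norm (d u) \<le> norm (d 0) + B u - B 0"
    using norm_triangle_ineq2[of "d u" "d 0"] by linarith
  then show False using u0 B0 init[of 0] c by auto
qed

section \<open>Functional differential equations with a Lipschitz right-hand side\<close>

text \<open>Banach's fixed point theorem in a norm with the weight \<open>exp (- 2 * K * t)\<close>, in which the
  integral operator has the Lipschitz constant \<open>1/2\<close> on all of \<open>{0..T}\<close> at once.  The initial
  history enters as a summand because \<open>hist_apply \<psi>\<close> is constant on \<open>{0..}\<close>.\<close>

lemma functional_ode_exists:
  fixes F :: "real \<Rightarrow> 'n::finite hist \<Rightarrow> real ^ 'n"
  assumes T: "0 \<le> T" and L: "0 \<le> L"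
    and cont: "\<And>y. continuous_on UNIV y \<Longrightarrow> continuous_on {0..T} (\<lambda>t. F t (seg y t))"
    and lip: "\<And>t w w'. t \<in> {0..T} \<Longrightarrow> norm (F t w - F t w') \<le> L * hist_seminorm j (w - w')"
  obtains y where "continuous_on UNIV y" "\<And>s. s \<le> 0 \<Longrightarrow> y s = hist_apply \<psi> s"
    "\<And>t. t \<in> {0..T} \<Longrightarrow> (y has_vector_derivative F t (seg y t)) (at t within {0..T})"
proof -
  \<comment> \<open>Clamping the time makes the weighted integral a bounded continuous function on
    the whole line, so that the complete space of such functions can be used.\<close>
  define c where "c t = max 0 (min t T)" for t :: real
  have c: "c t \<in> {0..T}" for t using T by (auto simp: c_def)
  have cc: "continuous_on A c" for A unfolding c_def by (intro continuous_intros)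
  define K where "K = L + 1"
  define Y where "Y u t = hist_apply \<psi> t + exp (2 * K * c t) *\<^sub>R apply_bcontfun u t"
    for u :: "(real, real ^ 'n) bcontfun" and t
  have Yc: "continuous_on A (Y u)" for A u
    unfolding Y_def by (intro continuous_intros cc continuous_on_hist_apply continuous_on_apply_bcontfun)
  define I where "I u t = integral {0..t} (\<lambda>s. F s (seg (Y u) s))" for u t
  have Fc: "continuous_on {0..t} (\<lambda>s. F s (seg (Y u) s))" if "t \<le> T" for u t
    using continuous_on_subset[OF cont[OF Yc]] that by auto
  have Ic: "continuous_on {0..T} (I u)" for u
    unfolding I_def by (intro indefinite_integral_continuous_1 integrable_continuous_real Fc) simp
  define P where "P u = (\<lambda>t. exp (- (2 * K * c t)) *\<^sub>R I u (c t))" for u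
  have P: "P u \<in> bcontfun" for u
  proof -
    let ?g = "\<lambda>r. exp (- (2 * K * r)) *\<^sub>R I u r"
    have g: "continuous_on {0..T} ?g" by (intro continuous_intros Ic)
    have "bounded (?g ` {0..T})" by (intro compact_imp_bounded compact_continuous_image g) simp
    then obtain b where "\<And>r. r \<in> {0..T} \<Longrightarrow> norm (?g r) \<le> b" by (force simp: bounded_iff)
    then have "norm (P u t) \<le> b" for t using c[of t] by (simp add: P_def)
    moreover have "continuous_on UNIV (P u)"
      unfolding P_def by (rule continuous_on_compose2[OF g cc]) (use c in auto)
    ultimately show ?thesis by (intro bcontfun_normI)
  qed
  have contr: "dist (Bcontfun (P u)) (Bcontfun (P w)) \<le> 1/2 * dist u w" for u w
  proof (rule dist_bound)
    fix t
    let ?D = "dist u w" and ?r = "c t"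
    have r: "0 \<le> ?r" "?r \<le> T" using c[of t] by auto
    have diff: "norm (F s (seg (Y u) s) - F s (seg (Y w) s)) \<le> K * (exp (2 * K * s) * ?D)"
      if s: "s \<in> {0..?r}" for s
    proof -
      \<comment> \<open>The weight is nondecreasing, so the whole past of \<open>s\<close> obeys the
        bound at \<open>s\<close>; hence the index \<open>j\<close> of the seminorm does not enter
        the contraction constant.\<close>
      have "norm (Y u q - Y w q) \<le> exp (2 * K * s) * ?D" if "q \<le> s" for q
      proof -
        have "norm (Y u q - Y w q) = exp (2 * K * c q) * dist (apply_bcontfun u q) (apply_bcontfun w q)"
          by (simp add: Y_def dist_norm flip: scaleR_diff_right)
        also have "\<dots> \<le> exp (2 * K * s) * ?D"
          using that s L by (intro mult_mono dist_bounded) (auto simp: K_def c_def)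
        finally show ?thesis .
      qed
      then have "hist_seminorm j (seg (Y u) s - seg (Y w) s) \<le> exp (2 * K * s) * ?D"
        by (intro hist_seminorm_seg_diff_le Yc)
      then have "K * hist_seminorm j (seg (Y u) s - seg (Y w) s) \<le> K * (exp (2 * K * s) * ?D)"
        using L by (intro mult_left_mono) (auto simp: K_def)
      moreover have "norm (F s (seg (Y u) s) - F s (seg (Y w) s)) \<le> L * hist_seminorm j (seg (Y u) s - seg (Y w) s)"
        by (rule lip) (use s r in auto)
      moreover have "L * hist_seminorm j (seg (Y u) s - seg (Y w) s) \<le> K * hist_seminorm j (seg (Y u) s - seg (Y w) s)"
        by (intro mult_right_mono hist_seminorm_nonneg) (simp add: K_def)
      ultimately show ?thesis by linarith
    qed
    have K: "K > 0" using L by (simp add: K_def)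
    \<comment> \<open>With the rate \<open>2 * K\<close>, twice the bound \<open>K\<close> on the
      Lipschitz constant, the integral is at most half of the weight at \<open>?r\<close>; this is
      the factor 1/2.\<close>
    have hi: "((\<lambda>s. K * (exp (2 * K * s) * ?D)) has_integral
        exp (2 * K * ?r) * ?D / 2 - exp (2 * K * 0) * ?D / 2) {0..?r}"
      using r K by (intro fundamental_theorem_of_calculus)
        (auto intro!: derivative_eq_intros simp flip: has_real_derivative_iff_has_vector_derivative)
    have "norm (I u ?r - I w ?r) = norm (integral {0..?r} (\<lambda>s. F s (seg (Y u) s) - F s (seg (Y w) s)))"
      unfolding I_def using r by (subst integral_diff) (auto intro!: integrable_continuous_real Fc)
    also have "\<dots> \<le> integral {0..?r} (\<lambda>s. K * (exp (2 * K * s) * ?D))"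
      using r diff hi by (intro integral_norm_bound_integral)
        (auto intro!: integrable_continuous_real continuous_intros Fc)
    also have "\<dots> \<le> exp (2 * K * ?r) * ?D / 2"
      unfolding integral_unique[OF hi] by simp
    finally have "exp (- (2 * K * ?r)) * norm (I u ?r - I w ?r) \<le> exp (- (2 * K * ?r)) * (exp (2 * K * ?r) * ?D / 2)"
      by (intro mult_left_mono) auto
    also have "\<dots> = 1/2 * ?D" by (simp add: exp_minus)
    finally show "dist (apply_bcontfun (Bcontfun (P u)) t) (apply_bcontfun (Bcontfun (P w)) t) \<le> 1/2 * ?D"
      by (simp add: Bcontfun_inverse P) (simp add: P_def dist_norm flip: scaleR_diff_right)
  qed
  obtain u where u: "Bcontfun (P u) = u"
    using banach_fix_type[of "1/2" "\<lambda>u. Bcontfun (P u)"] contr by auto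
  have "apply_bcontfun u = P u" using u P[of u] by (metis Bcontfun_inverse)
  \<comment> \<open>For an arbitrary \<open>u\<close> the function \<open>Y u\<close> need not have
    the history \<psi>; at the fixed point it does, since the integral from 0 to \<open>c t\<close>
    = 0 vanishes for \<open>t\<close> \<le> 0.\<close>
  then have Yeq: "Y u t = hist_apply \<psi> t + I u (c t)" for t
    by (simp add: Y_def P_def flip: exp_add)
  show ?thesis
  proof
    show "continuous_on UNIV (Y u)" by (rule Yc)
    show "Y u s = hist_apply \<psi> s" if "s \<le> 0" for s
      using that T by (simp add: Yeq c_def I_def)
    fix t assume t: "t \<in> {0..T}"
    have "((\<lambda>r. hist_apply \<psi> 0 + I u r) has_vector_derivative F t (seg (Y u) t)) (at t within {0..T})"
      unfolding I_def using integral_has_vector_derivative[OF Fc[OF order_refl] t, of u]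
      by (auto intro!: derivative_eq_intros)
    then show "(Y u has_vector_derivative F t (seg (Y u) t)) (at t within {0..T})"
    proof (rule has_vector_derivative_transform[OF t, rotated])
      fix r assume r: "r \<in> {0..T}"
      have "hist_apply \<psi> r = hist_apply \<psi> 0"
        using hist_apply[of \<psi>] r by (cases "r = 0") auto
      with r show "Y u r = hist_apply \<psi> 0 + I u r" by (simp add: Yeq c_def)
    qed
  qed
qed

section \<open>Directional derivatives\<close>

lemma has_dir_deriv_unique:
  "has_dir_deriv g u v d \<Longrightarrow> dir_deriv g u v = d"
  unfolding has_dir_deriv_def dir_deriv_def by (intro tendsto_Lim) auto

lemma has_dir_deriv_dir_deriv:
  "dir_differentiable g u v \<Longrightarrow> has_dir_deriv g u v (dir_deriv g u v)"
  unfolding dir_differentiable_def using has_dir_deriv_unique by metis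

text \<open>Substitute \<open>t * c\<close> for \<open>t\<close> in the difference quotient.
  Linearity is not part of \<open>C1_MB\<close>, so homogeneity has to be derived; the scaling
  argument that bounds the derivative rests on it.\<close>

lemma has_dir_deriv_scaleR:
  fixes g :: "'v::{real_vector,topological_space} \<Rightarrow> 'w::real_normed_vector"
  assumes "has_dir_deriv g u v d"
  shows "has_dir_deriv g u (c *\<^sub>R v) (c *\<^sub>R d)"
proof (cases "c = 0")
  case False
  have lim: "filterlim (\<lambda>t. t * c) (at 0) (at 0)"
    using False by (auto simp: filterlim_at intro!: tendsto_eq_intros eventually_at_ball'[of 1])
      (auto simp: eventually_at intro: exI[of _ 1])
  have "((\<lambda>t. c *\<^sub>R ((1 / (t * c)) *\<^sub>R (g (u + (t * c) *\<^sub>R v) - g u))) \<longlongrightarrow> c *\<^sub>R d) (at 0)"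
    using filterlim_compose[OF assms[unfolded has_dir_deriv_def] lim] by (intro tendsto_intros)
  then show ?thesis using False by (simp add: has_dir_deriv_def)
qed (simp add: has_dir_deriv_def)

text \<open>Restriction to a line turns directional derivatives into derivatives in one real
  variable, to which the mean value inequality applies.\<close>

lemma has_dir_deriv_line:
  fixes g :: "'v::{real_vector,topological_space} \<Rightarrow> 'w::real_normed_vector"
  assumes "has_dir_deriv g (u + s *\<^sub>R v) v d"
  shows "((\<lambda>r. g (u + r *\<^sub>R v)) has_vector_derivative d) (at s)"
proof -
  have "((\<lambda>t. (1/t) *\<^sub>R (g (u + s *\<^sub>R v + t *\<^sub>R v) - g (u + s *\<^sub>R v)) - d) \<longlongrightarrow> 0) (at 0)"
    using assms unfolding has_dir_deriv_def by (rule LIM_zero)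
  then have "((\<lambda>t. norm ((1/t) *\<^sub>R (g (u + s *\<^sub>R v + t *\<^sub>R v) - g (u + s *\<^sub>R v)) - d)) \<longlongrightarrow> 0) (at 0)"
    by (rule tendsto_norm_zero)
  then have "((\<lambda>t. norm (g (u + (s + t) *\<^sub>R v) - g (u + s *\<^sub>R v) - t *\<^sub>R d) / norm t) \<longlongrightarrow> 0) (at 0)"
  proof (rule Lim_transform_eventually)
    show "\<forall>\<^sub>F t in at 0. norm ((1/t) *\<^sub>R (g (u + s *\<^sub>R v + t *\<^sub>R v) - g (u + s *\<^sub>R v)) - d) =
        norm (g (u + (s + t) *\<^sub>R v) - g (u + s *\<^sub>R v) - t *\<^sub>R d) / norm t"
      unfolding eventually_at
    proof (intro exI[of _ 1] conjI ballI impI)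
      fix t :: real assume t: "t \<noteq> 0 \<and> dist t 0 < 1"
      let ?a = "g (u + (s + t) *\<^sub>R v) - g (u + s *\<^sub>R v)"
      have "(1/t) *\<^sub>R ?a - d = (1/t) *\<^sub>R (?a - t *\<^sub>R d)" using t by (simp add: scaleR_diff_right)
      then have "norm ((1/t) *\<^sub>R ?a - d) = norm (?a - t *\<^sub>R d) / norm t" by (simp add: divide_inverse mult.commute)
      then show "norm ((1/t) *\<^sub>R (g (u + s *\<^sub>R v + t *\<^sub>R v) - g (u + s *\<^sub>R v)) - d) =
        norm (?a - t *\<^sub>R d) / norm t" by (simp add: scaleR_add_left add.assoc)
    qed simp
  qed
  then show ?thesis
    unfolding has_vector_derivative_def has_derivative_at
    by (auto simp: bounded_linear_scaleR_left)
qed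

section \<open>Reduction of the F case to the MB case\<close>

text \<open>Sequences suffice, and a convergent sequence of directions is bounded.\<close>

lemma C1_F_imp_C1_MB:
  fixes g :: "'n::finite hist \<Rightarrow> 'w::real_normed_vector"
  assumes F: "C1_F X g"
  shows "C1_MB X g"
proof -
  have X: "open X" and lin: "\<And>u. u \<in> X \<Longrightarrow> dir_deriv g u \<in> Lc"
    and cm: "continuous_map (top_of_set X) Lc_topology (dir_deriv g)"
    using F by (auto simp: C1_F_def)
  have "((\<lambda>(u, v). dir_deriv g u v) \<longlongrightarrow> dir_deriv g u0 v0) (at (u0, v0) within X \<times> UNIV)"
    if u0: "u0 \<in> X" for u0 v0
  proof (rule tendstoI, rule ccontr)
    fix e :: real assume e: "e > 0"
    let ?D = "dir_deriv g"
    assume not: "\<not> (\<forall>\<^sub>F x in at (u0, v0) within X \<times> UNIV.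
        dist (case x of (u, v) \<Rightarrow> ?D u v) (?D u0 v0) < e)"
    \<comment> \<open>Index and radius are tied together: since the seminorms increase, points
      chosen in the \<open>k\<close>-th ball of radius 1/(k+1) converge in every seminorm.\<close>
    have "\<exists>u v. u \<in> X \<and> hist_seminorm k (u - u0) < 1 / real (Suc k) \<and>
        hist_seminorm k (v - v0) < 1 / real (Suc k) \<and> \<not> dist (?D u v) (?D u0 v0) < e" for k
    proof (rule ccontr)
      let ?A = "{u. hist_seminorm k (u - u0) < 1 / real (Suc k)}"
      let ?B = "{v. hist_seminorm k (v - v0) < 1 / real (Suc k)}"
      assume "\<not> ?thesis"
      moreover have "open (?A \<times> ?B)" by (intro open_Times open_hist_ball)
      moreover have "(u0, v0) \<in> ?A \<times> ?B" by simp
      ultimately have "\<forall>\<^sub>F x in at (u0, v0) within X \<times> UNIV. dist (case x of (u, v) \<Rightarrow> ?D u v) (?D u0 v0) < e"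
        unfolding eventually_at_topological by (intro exI[of _ "?A \<times> ?B"]) auto
      with not show False by simp
    qed
    then obtain p q where pq: "\<And>k. p k \<in> X" "\<And>k. hist_seminorm k (p k - u0) < 1 / real (Suc k)"
      "\<And>k. hist_seminorm k (q k - v0) < 1 / real (Suc k)" "\<And>k. \<not> dist (?D (p k) (q k)) (?D u0 v0) < e"
      by metis
    have lim: "r \<longlonglongrightarrow> w" if "\<And>k. hist_seminorm k (r k - w) < 1 / real (Suc k)" for r and w :: "'n hist"
      unfolding tendsto_hist_iff
    proof
      fix j
      have "\<forall>\<^sub>F k in sequentially. norm (hist_seminorm j (r k - w)) \<le> 1 / real (Suc k)"
        using eventually_ge_at_top[of j]
      proof eventually_elim
        case (elim k)
        then show ?case
          using that[of k] hist_seminorm_mono[of j k "r k - w"] hist_seminorm_nonneg[of j "r k - w"] by simp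
      qed
      then show "(\<lambda>k. hist_seminorm j (r k - w)) \<longlonglongrightarrow> 0"
        by (rule Lim_null_comparison) (rule LIMSEQ_Suc[OF lim_1_over_n])
    qed
    have p: "p \<longlonglongrightarrow> u0" and q: "q \<longlonglongrightarrow> v0" using lim pq by auto
    have bdd: "tvs_bounded (range q)"
      unfolding tvs_bounded_def
    proof (intro allI impI)
      fix N :: "'n hist set" assume "open N \<and> 0 \<in> N"
      then obtain j d where d: "d > 0" "{\<psi>. hist_seminorm j (\<psi> - 0) < d} \<subseteq> N"
        unfolding open_hist_def by blast
      have "Bseq (\<lambda>k. hist_seminorm j (q k - v0))"
        by (intro convergent_imp_Bseq convergentI[of _ 0] tendsto_histD[OF q])
      then obtain M where M: "\<And>k. hist_seminorm j (q k - v0) \<le> M"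
        by (auto simp: Bseq_def hist_seminorm_nonneg)
      define M' where "M' = M + hist_seminorm j v0"
      have M': "hist_seminorm j (q k) \<le> M'" for k
        using M[of k] hist_seminorm_add[of j "q k - v0" v0] by (simp add: M'_def)
      have M'0: "M' \<ge> 0" using M'[of 0] hist_seminorm_nonneg[of j "q 0"] by linarith
      \<comment> \<open>Division by \<open>r\<close> > \<open>M' / d\<close> moves every
        \<open>q k\<close> into the ball of radius \<open>d\<close>; the summand 1 keeps the
        threshold positive when \<open>M'\<close> = 0.\<close>
      show "\<exists>s>0. \<forall>r>s. range q \<subseteq> (\<lambda>x. r *\<^sub>R x) ` N"
      proof (intro exI[of _ "M' / d + 1"] conjI allI impI subsetI)
        show "0 < M' / d + 1" using M'0 d by (auto intro!: add_nonneg_pos)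
        fix r x assume r: "M' / d + 1 < r" and "x \<in> range q"
        then obtain k where x: "x = q k" by auto
        have r0: "r > 0" using r M'0 d by (smt (verit) divide_nonneg_pos)
        have "M' / d < r" using r by linarith
        then have rd: "M' < r * d" using d by (simp add: pos_divide_less_eq)
        have "hist_seminorm j ((1/r) *\<^sub>R q k) \<le> (1/r) * M'"
          using hist_seminorm_scaleR[of j "1/r" "q k"] mult_left_mono[OF M'[of k], of "1/r"] r0 by simp
        also have "\<dots> < d" using rd r0 by (simp add: pos_divide_less_eq mult.commute)
        finally have "(1/r) *\<^sub>R q k \<in> N" using d(2) by auto
        then show "x \<in> (\<lambda>x. r *\<^sub>R x) ` N"
          using r0 x by (intro image_eqI[of _ _ "(1/r) *\<^sub>R q k"]) auto
      qed
    qed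
    \<comment> \<open>The bound \<delta> is uniform in \<open>v\<close> and strictly below
      \<open>e/2\<close>. A pointwise strict inequality on the infinite set \<open>range q\<close>
      would leave no common margin, and the openness of \<open>?W\<close> needs one.\<close>
    let ?W = "{S \<in> Lc. \<exists>\<delta><e/2. \<forall>v\<in>range q. norm (S v - ?D u0 v) \<le> \<delta>}"
    have "openin Lc_topology ?W"
      unfolding openin_Lc_topology Lc_open_def
    proof (intro conjI ballI)
      fix T assume "T \<in> ?W"
      then obtain \<delta> where \<delta>: "\<delta> < e/2" "\<And>v. v \<in> range q \<Longrightarrow> norm (T v - ?D u0 v) \<le> \<delta>" by auto
      define \<rho> where "\<rho> = (e/2 - \<delta>) / 2"
      have \<rho>: "\<rho> > 0" "\<delta> + \<rho> < e/2" using \<delta> by (auto simp: \<rho>_def field_simps)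
      have "norm (S v - ?D u0 v) \<le> \<delta> + \<rho>" if "v \<in> range q" "S v - T v \<in> ball 0 \<rho>" for S v
        using norm_triangle_ineq[of "S v - T v" "T v - ?D u0 v"] \<delta>(2)[OF that(1)] that(2) by simp
      then have "{S \<in> Lc. \<forall>v\<in>range q. S v - T v \<in> ball 0 \<rho>} \<subseteq> ?W" using \<rho> by blast
      then show "\<exists>B N. tvs_bounded B \<and> open N \<and> 0 \<in> N \<and> {S \<in> Lc. \<forall>v\<in>B. S v - T v \<in> N} \<subseteq> ?W"
        using bdd \<rho> by (intro exI[of _ "range q"] exI[of _ "ball 0 \<rho>"]) auto
    qed auto
    from openin_continuous_map_preimage[OF cm this]
    have "openin (top_of_set X) {u \<in> X. ?D u \<in> ?W}" by simp
    then have "open {u \<in> X. ?D u \<in> ?W}" using X openin_open_eq by blast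
    moreover have "u0 \<in> {u \<in> X. ?D u \<in> ?W}" using u0 lin e by (auto intro!: exI[of _ 0])
    ultimately have ev1: "\<forall>\<^sub>F k in sequentially. p k \<in> {u \<in> X. ?D u \<in> ?W}"
      using topological_tendstoD[OF p] by blast
    have "isCont (?D u0) v0"
      using lin[OF u0] by (simp add: Lc_def continuous_on_eq_continuous_at)
    then have "(\<lambda>k. ?D u0 (q k)) \<longlonglongrightarrow> ?D u0 v0"
      using q isCont_tendsto_compose by blast
    then have ev2: "\<forall>\<^sub>F k in sequentially. dist (?D u0 (q k)) (?D u0 v0) < e/2"
      using e by (intro tendstoD) auto
    from eventually_conj[OF ev1 ev2] obtain k where
      k: "?D (p k) \<in> ?W" "dist (?D u0 (q k)) (?D u0 v0) < e/2"
      by (auto dest!: eventually_happens)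
    from k(1) obtain \<delta> where "\<delta> < e/2" "norm (?D (p k) (q k) - ?D u0 (q k)) \<le> \<delta>" by auto
    then have "dist (?D (p k) (q k)) (?D u0 v0) < e"
      using k(2) dist_triangle[of "?D (p k) (q k)" "?D u0 v0" "?D u0 (q k)"] by (simp add: dist_norm)
    with pq(4) show False by blast
  qed
  then have "continuous_on (X \<times> UNIV) (\<lambda>(u, v). dir_deriv g u v)"
    unfolding continuous_on_def by auto
  with F show ?thesis by (auto simp: C1_F_def C1_MB_def)
qed

section \<open>Bounds on the derivative by a single seminorm\<close>

lemma tendsto_hist_seminorm:
  assumes "(g \<longlongrightarrow> l) F"
  shows "((\<lambda>x. hist_seminorm j (g x)) \<longlongrightarrow> hist_seminorm j l) F"
proof -
  have "\<bar>hist_seminorm j (g x) - hist_seminorm j l\<bar> \<le> hist_seminorm j (g x - l)" for x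
    using hist_seminorm_add[of j "g x - l" l] hist_seminorm_add[of j "l - g x" "g x"]
      hist_seminorm_commute[of j l "g x"] by simp
  then have "((\<lambda>x. hist_seminorm j (g x) - hist_seminorm j l) \<longlongrightarrow> 0) F"
    by (intro Lim_null_comparison[OF always_eventually tendsto_histD[OF assms, of j]]) simp
  then show ?thesis by (simp add: LIM_zero_iff)
qed

lemma continuous_on_hist_seminorm:
  "continuous_on A g \<Longrightarrow> continuous_on A (\<lambda>x. hist_seminorm j (g x))"
  unfolding continuous_on_def by (blast intro: tendsto_hist_seminorm)

lemma continuous_on_scaleR_hist:
  fixes g :: "'b::topological_space \<Rightarrow> 'n::finite hist"
  shows "continuous_on A c \<Longrightarrow> continuous_on A g \<Longrightarrow> continuous_on A (\<lambda>x. c x *\<^sub>R g x)"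
  unfolding continuous_on_def by (blast intro: tendsto_scaleR_hist)

lemma C1_MB_has_dir_deriv:
  "C1_MB X g \<Longrightarrow> u \<in> X \<Longrightarrow> has_dir_deriv g u v (dir_deriv g u v)"
  by (auto simp: C1_MB_def intro: has_dir_deriv_dir_deriv)

lemma C1_MB_dir_deriv_scaleR:
  fixes g :: "'v::{real_vector,topological_space} \<Rightarrow> 'w::real_normed_vector"
  shows "C1_MB X g \<Longrightarrow> u \<in> X \<Longrightarrow> dir_deriv g u (c *\<^sub>R v) = c *\<^sub>R dir_deriv g u v"
  by (intro has_dir_deriv_unique has_dir_deriv_scaleR C1_MB_has_dir_deriv)

lemma continuous_on_dir_deriv:
  assumes "C1_MB X g" "continuous_on A a" "continuous_on A b" "\<And>t. t \<in> A \<Longrightarrow> a t \<in> X"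
  shows "continuous_on A (\<lambda>t. dir_deriv g (a t) (b t))"
proof -
  have "continuous_on (X \<times> UNIV) (\<lambda>p. dir_deriv g (fst p) (snd p))"
    using assms(1) by (simp add: C1_MB_def case_prod_unfold)
  from continuous_on_compose2[OF this continuous_on_Pair[OF assms(2,3)]] assms(4)
  show ?thesis by auto
qed

text \<open>The radius and the constant are tied to the index of the seminorm, so that the property
  passes to larger indices and one index serves a whole compact set of centres.\<close>

definition dir_bounded_near ::
    "('n::finite hist \<Rightarrow> 'w::real_normed_vector) \<Rightarrow> 'n hist set \<Rightarrow> nat \<Rightarrow> 'n hist \<Rightarrow> bool"
  where "dir_bounded_near g X k c \<longleftrightarrow> (\<forall>u. hist_seminorm k (u - c) < 1 / real (Suc k) \<longrightarrow>
    u \<in> X \<and> (\<forall>v. norm (dir_deriv g u v) \<le> real k * hist_seminorm k v))"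

lemma C1_MB_locally_dir_bounded:
  fixes g :: "'n::finite hist \<Rightarrow> 'w::real_normed_vector"
  assumes g: "C1_MB X g" and c: "c \<in> X"
  obtains j \<delta> L where "\<delta> > 0" "\<And>u. hist_seminorm j (u - c) < \<delta> \<Longrightarrow> u \<in> X"
    "\<And>u v. hist_seminorm j (u - c) < \<delta> \<Longrightarrow> norm (dir_deriv g u v) \<le> L * hist_seminorm j v"
proof -
  let ?D = "dir_deriv g"
  have "continuous_on (X \<times> UNIV) (\<lambda>p. ?D (fst p) (snd p))"
    by (intro continuous_on_dir_deriv[OF g] continuous_intros) auto
  moreover have "?D c 0 = 0"
    using C1_MB_dir_deriv_scaleR[OF g c, of 0 0] by simp
  moreover have "open (X \<times> (UNIV :: 'n hist set))"
    using g by (intro open_Times) (auto simp: C1_MB_def)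
  ultimately have "open ((\<lambda>p. ?D (fst p) (snd p)) -` ball 0 1 \<inter> X \<times> UNIV)"
    by (simp add: continuous_on_open_vimage)
  moreover have "(c, 0) \<in> (\<lambda>p. ?D (fst p) (snd p)) -` ball 0 1 \<inter> X \<times> UNIV"
    using c \<open>?D c 0 = 0\<close> by simp
  ultimately obtain A B where AB: "open A" "open B" "(c, 0) \<in> A \<times> B"
    "A \<times> B \<subseteq> (\<lambda>p. ?D (fst p) (snd p)) -` ball 0 1 \<inter> X \<times> UNIV"
    by (elim open_prod_elim) auto
  obtain j1 d1 where 1: "d1 > 0" "{u. hist_seminorm j1 (u - c) < d1} \<subseteq> A"
    using AB(1,3) unfolding open_hist_def by blast
  obtain j2 d2 where 2: "d2 > 0" "{v. hist_seminorm j2 (v - 0) < d2} \<subseteq> B"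
    using AB(2,3) unfolding open_hist_def by blast
  define j where "j = max j1 j2"
  define d where "d = min d1 d2"
  have d: "d > 0" using 1 2 by (simp add: d_def)
  have A: "u \<in> A" if "hist_seminorm j (u - c) < d" for u
    using that 1(2) hist_seminorm_mono[of j1 j "u - c"] by (auto simp: j_def d_def)
  have B: "v \<in> B" if "hist_seminorm j v < d" for v
    using that 2(2) hist_seminorm_mono[of j2 j v] by (auto simp: j_def d_def)
  show ?thesis
  proof
    show "d > 0" by fact
    show uX: "u \<in> X" if "hist_seminorm j (u - c) < d" for u
      using A[OF that] AB(3,4) by auto
    fix u v assume u: "hist_seminorm j (u - c) < d"
    show "norm (?D u v) \<le> 2 / d * hist_seminorm j v"
    proof (rule field_le_epsilon)
      fix e :: real assume e: "e > 0"
      \<comment> \<open>A nonzero \<open>v\<close> can have seminorm 0, so one cannot normalise by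
        it. The added term keeps \<open>r\<close> positive and turns \<open>2 * r / d\<close> into
        the desired bound plus \<open>e\<close>; the factor 2 puts the scaled vector strictly inside
        the ball.\<close>
      define r where "r = hist_seminorm j v + e * d / 2"
      have r: "r > 0" "hist_seminorm j v < r" using e d hist_seminorm_nonneg[of j v]
        by (auto simp: r_def intro!: add_nonneg_pos)
      have "hist_seminorm j ((d / (2 * r)) *\<^sub>R v) \<le> d / (2 * r) * hist_seminorm j v"
        using hist_seminorm_scaleR[of j "d / (2 * r)" v] r d by simp
      also have "\<dots> \<le> d / (2 * r) * r" using r d by (intro mult_left_mono) auto
      also have "\<dots> < d" using r d by simp
      finally have "norm (?D u ((d / (2 * r)) *\<^sub>R v)) < 1"
        using A[OF u] B AB(4) by fastforce
      then have "d / (2 * r) * norm (?D u v) < 1"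
        using r d by (simp add: C1_MB_dir_deriv_scaleR[OF g uX[OF u]])
      then have "norm (?D u v) < 2 * r / d" using r d by (simp add: field_simps)
      then show "norm (?D u v) \<le> 2 / d * hist_seminorm j v + e"
        using d by (simp add: r_def field_simps)
    qed
  qed
qed

text \<open>If every index fails, the points of failure form a sequence numbered by the indices.
  Near a limit point the local bound has a fixed seminorm, radius and constant, and these are good
  enough for all large indices, which contradicts failure there.\<close>

lemma C1_MB_dir_bounded_near_compact:
  fixes g :: "'n::finite hist \<Rightarrow> 'w::real_normed_vector" and c :: "'b::metric_space \<Rightarrow> 'n hist"
  assumes g: "C1_MB X g" and K: "compact K" "continuous_on K c" "\<And>t. t \<in> K \<Longrightarrow> c t \<in> X"
  obtains k where "\<And>t. t \<in> K \<Longrightarrow> dir_bounded_near g X k (c t)"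
proof (rule ccontr)
  assume "\<not> thesis"
  with that have "\<forall>k. \<exists>t. t \<in> K \<and> \<not> dir_bounded_near g X k (c t)" by blast
  then obtain t where t: "\<And>k. t k \<in> K" "\<And>k. \<not> dir_bounded_near g X k (c (t k))" by metis
  then obtain l r where lr: "l \<in> K" "strict_mono (r :: nat \<Rightarrow> nat)" "(t \<circ> r) \<longlonglongrightarrow> l"
    using K(1) unfolding compact_def by metis
  obtain j \<delta> L where j: "\<delta> > 0" "\<And>u. hist_seminorm j (u - c l) < \<delta> \<Longrightarrow> u \<in> X"
    "\<And>u v. hist_seminorm j (u - c l) < \<delta> \<Longrightarrow> norm (dir_deriv g u v) \<le> L * hist_seminorm j v"
    using C1_MB_locally_dir_bounded[OF g K(3)[OF lr(1)]] by metis
  have "(\<lambda>n. c ((t \<circ> r) n)) \<longlonglongrightarrow> c l"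
    by (rule continuous_on_tendsto_compose[OF K(2) lr(3,1)]) (use t in auto)
  from tendsto_histD[OF this, of j]
  have ev1: "\<forall>\<^sub>F n in sequentially. hist_seminorm j (c (t (r n)) - c l) < \<delta> / 2"
    using j(1) by (intro order_tendstoD(2)) auto
  \<comment> \<open>Beyond \<open>N\<close> the seminorm dominates the \<open>j\<close>-th one, the
    constant dominates \<open>L\<close>, and the radius is below \<delta>/2; the other \<delta>/2 is
    spent on the distance of the centres.\<close>
  obtain N where N: "max (real j) (max L (2 / \<delta>)) \<le> real N" using real_arch_simple by blast
  from eventually_happens[OF eventually_conj[OF ev1 eventually_ge_at_top[of N]]]
  obtain n where n: "hist_seminorm j (c (t (r n)) - c l) < \<delta> / 2" "N \<le> n" by auto
  define k where "k = r n"
  have kn: "n \<le> k" using lr(2) by (simp add: k_def strict_mono_imp_increasing)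
  then have k: "j \<le> k" "L \<le> real k" "2 / \<delta> < real (Suc k)" using n N by auto
  then have k3: "1 / real (Suc k) < \<delta> / 2"
    using j(1) by (auto simp: field_simps simp del: of_nat_Suc)
  have "dir_bounded_near g X k (c (t k))"
    unfolding dir_bounded_near_def
  proof (intro allI impI)
    fix u assume u: "hist_seminorm k (u - c (t k)) < 1 / real (Suc k)"
    have "hist_seminorm j (u - c l) < \<delta>"
      using hist_seminorm_triangle[of j u "c l" "c (t k)"] u k3 n(1)
        hist_seminorm_mono[OF k(1), of "u - c (t k)"] by (simp add: k_def)
    note * = j(2,3)[OF this]
    show "u \<in> X \<and> (\<forall>v. norm (dir_deriv g u v) \<le> real k * hist_seminorm k v)"
    proof (intro conjI allI)
      fix v :: "'n hist"
      have "L * hist_seminorm j v \<le> real k * hist_seminorm k v"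
        using k hist_seminorm_mono[OF k(1), of v] by (intro mult_mono) (auto simp: hist_seminorm_nonneg)
      with *(2)[of v] show "norm (dir_deriv g u v) \<le> real k * hist_seminorm k v" by linarith
    qed (rule *(1))
  qed
  with t(2) show False by blast
qed

section \<open>Mean value estimates in seminorm balls\<close>

lemma dir_bounded_near_lipschitz:
  fixes g :: "'n::finite hist \<Rightarrow> 'w::real_normed_vector"
  assumes g: "C1_MB X g" and c: "dir_bounded_near g X k c"
    and u: "hist_seminorm k (u - c) < 1 / real (Suc k)" and w: "hist_seminorm k (w - c) < 1 / real (Suc k)"
  shows "norm (g u - g w) \<le> real k * hist_seminorm k (u - w)"
proof -
  let ?p = "\<lambda>s. w + s *\<^sub>R (u - w)" and ?M = "real k * hist_seminorm k (u - w)"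
  have near: "hist_seminorm k (?p s - c) < 1 / real (Suc k)" if "0 \<le> s" "s \<le> 1" for s
  proof -
    have "?p s - c = s *\<^sub>R (u - c) + (1 - s) *\<^sub>R (w - c)" by (simp add: algebra_simps)
    then have "hist_seminorm k (?p s - c) \<le> s * hist_seminorm k (u - c) + (1 - s) * hist_seminorm k (w - c)"
      using hist_seminorm_add[of k "s *\<^sub>R (u - c)" "(1 - s) *\<^sub>R (w - c)"]
        hist_seminorm_scaleR[of k s "u - c"] hist_seminorm_scaleR[of k "1 - s" "w - c"] that by simp
    also have "\<dots> < 1 / real (Suc k)"
      using that u w by (intro convex_bound_lt) auto
    finally show ?thesis .
  qed
  have D: "((\<lambda>s. g (?p s)) has_vector_derivative dir_deriv g (?p s) (u - w)) (at s)"
    "norm (dir_deriv g (?p s) (u - w)) \<le> ?M" if "0 \<le> s" "s \<le> 1" for s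
    using near[OF that] c
    by (auto simp: dir_bounded_near_def intro!: has_dir_deriv_line C1_MB_has_dir_deriv[OF g])
  have "norm (g (?p 1) - g (?p 0)) \<le> ?M * 1 - ?M * 0"
  proof (rule differentiable_bound_general[where \<phi>' = "\<lambda>_. ?M" and f' = "\<lambda>s. dir_deriv g (?p s) (u - w)"])
    show "continuous_on {0..1} (\<lambda>s. g (?p s))"
      using D(1) by (intro continuous_at_imp_continuous_on ballI has_vector_derivative_continuous) auto
    show "((*) ?M has_vector_derivative ?M) (at s)" for s
      by (auto intro!: derivative_eq_intros simp flip: has_real_derivative_iff_has_vector_derivative)
  qed (use D in \<open>auto intro!: continuous_intros\<close>)
  then show ?thesis by simp
qed

lemma eventually_near_line:
  fixes c v :: "'n::finite hist"
  assumes "e > 0"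
  shows "\<forall>\<^sub>F t in at 0. hist_seminorm k (c + t *\<^sub>R v - c) < e"
proof -
  have "((\<lambda>t. t *\<^sub>R v) \<longlongrightarrow> 0 *\<^sub>R v) (at 0)"
    by (intro tendsto_scaleR_hist tendsto_intros)
  from tendsto_hist_seminorm[OF this, of k] show ?thesis
    using assms by (simp add: order_tendstoD(2))
qed

text \<open>The derivative is a pointwise limit of difference quotients that are Lipschitz with one constant;
  so additivity of \<open>dir_deriv g c\<close> never has to be proved.\<close>

lemma dir_bounded_near_dir_deriv_lipschitz:
  fixes g :: "'n::finite hist \<Rightarrow> 'w::real_normed_vector"
  assumes g: "C1_MB X g" and c: "dir_bounded_near g X k c"
  shows "norm (dir_deriv g c v - dir_deriv g c w) \<le> real k * hist_seminorm k (v - w)"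
proof -
  have "c \<in> X" using c by (auto simp: dir_bounded_near_def)
  then have lim: "((\<lambda>t. (1/t) *\<^sub>R (g (c + t *\<^sub>R v) - g c) - (1/t) *\<^sub>R (g (c + t *\<^sub>R w) - g c)) \<longlongrightarrow>
      dir_deriv g c v - dir_deriv g c w) (at 0)"
    using C1_MB_has_dir_deriv[OF g] unfolding has_dir_deriv_def by (intro tendsto_intros) auto
  show ?thesis
  proof (rule Lim_norm_ubound[OF _ lim])
    have "\<forall>\<^sub>F t in at 0. t \<noteq> (0::real)" by (simp add: eventually_at_filter)
    moreover have "\<forall>\<^sub>F t in at 0. hist_seminorm k (c + t *\<^sub>R z - c) < 1 / real (Suc k)" for z
      by (rule eventually_near_line) simp
    note this[of v] this[of w]
    ultimately show "\<forall>\<^sub>F t in at 0. norm ((1/t) *\<^sub>R (g (c + t *\<^sub>R v) - g c) - (1/t) *\<^sub>R (g (c + t *\<^sub>R w) - g c))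
        \<le> real k * hist_seminorm k (v - w)"
    proof eventually_elim
      case (elim t)
      let ?u = "c + t *\<^sub>R v" and ?w = "c + t *\<^sub>R w"
      have "norm (g ?u - g ?w) \<le> real k * hist_seminorm k (t *\<^sub>R (v - w))"
        using dir_bounded_near_lipschitz[OF g c, of ?u ?w] elim by (simp add: scaleR_diff_right)
      also have "\<dots> \<le> real k * (\<bar>t\<bar> * hist_seminorm k (v - w))"
        by (intro mult_left_mono hist_seminorm_scaleR) auto
      finally have "\<bar>1/t\<bar> * norm (g ?u - g ?w) \<le> \<bar>1/t\<bar> * (real k * (\<bar>t\<bar> * hist_seminorm k (v - w)))"
        by (intro mult_left_mono) auto
      moreover have "(1/t) *\<^sub>R (g ?u - g c) - (1/t) *\<^sub>R (g ?w - g c) = (1/t) *\<^sub>R (g ?u - g ?w)"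
        by (simp add: scaleR_diff_right)
      ultimately show ?case using elim by simp
    qed
  qed simp
qed

text \<open>Only the compact family of directions \<open>V t\<close> matters. On it joint continuity
  of the derivative becomes uniform continuity in \<open>(s, t)\<close>, which takes the place of
  continuity in an operator norm.\<close>

lemma C1_MB_remainder_uniform:
  fixes g :: "'n::finite hist \<Rightarrow> 'w::real_normed_vector" and c :: "'b::metric_space \<Rightarrow> 'n hist"
  assumes g: "C1_MB X g" and K: "compact K" and c: "continuous_on K c" and V: "continuous_on K V"
    and near: "\<And>t. t \<in> K \<Longrightarrow> dir_bounded_near g X k (c t)" and e: "e > 0"
  shows "\<forall>\<^sub>F h in at 0. \<forall>t\<in>K. hist_seminorm k (c t + h *\<^sub>R V t - c t) < 1 / real (Suc k) \<and>
    norm (g (c t + h *\<^sub>R V t) - g (c t) - h *\<^sub>R dir_deriv g (c t) (V t)) \<le> \<bar>h\<bar> * e"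
proof -
  have "bounded ((\<lambda>t. hist_seminorm k (V t)) ` K)"
    by (intro compact_imp_bounded compact_continuous_image continuous_on_hist_seminorm V K)
  then obtain M where M: "M > 0" "\<And>t. t \<in> K \<Longrightarrow> hist_seminorm k (V t) \<le> M"
    unfolding bounded_pos by (auto simp: hist_seminorm_nonneg)
  \<comment> \<open>For \<bar>s\<bar> \<le> \<open>a\<close> the displacement
    \<open>s *\<^sub>R V t\<close> has seminorm at most half of the radius 1/(k+1).\<close>
  define a where "a = 1 / (2 * M * real (Suc k))"
  have a: "a > 0" using M by (simp add: a_def)
  have ball: "hist_seminorm k (c t + s *\<^sub>R V t - c t) < 1 / real (Suc k)" if "\<bar>s\<bar> \<le> a" "t \<in> K" for s t
  proof -
    have "hist_seminorm k (s *\<^sub>R V t) \<le> a * M"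
      using hist_seminorm_scaleR[of k s "V t"] mult_mono[OF that(1) M(2)[OF that(2)]] a
      by (simp add: hist_seminorm_nonneg)
    also have "a * M = 1 / (2 * real (Suc k))" using M(1) by (simp add: a_def)
    also have "\<dots> < 1 / real (Suc k)" by (intro divide_strict_left_mono) auto
    finally show ?thesis by simp
  qed
  have inX: "c t + s *\<^sub>R V t \<in> X" if "\<bar>s\<bar> \<le> a" "t \<in> K" for s t
    using ball[OF that] near[OF that(2)] by (auto simp: dir_bounded_near_def)
  let ?Q = "{-a..a} \<times> K"
  let ?\<Phi> = "\<lambda>p. dir_deriv g (c (snd p) + fst p *\<^sub>R V (snd p)) (V (snd p))"
  have cs: "continuous_on ?Q (\<lambda>p. c (snd p))" "continuous_on ?Q (\<lambda>p. V (snd p))"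
    by (rule continuous_on_compose2[OF c] continuous_on_compose2[OF V], auto intro!: continuous_intros)+
  have "continuous_on ?Q ?\<Phi>"
    by (intro continuous_on_dir_deriv[OF g] continuous_on_add continuous_on_scaleR_hist cs
        continuous_on_fst continuous_on_id) (auto intro!: inX)
  then have "uniformly_continuous_on ?Q ?\<Phi>"
    by (intro compact_uniformly_continuous compact_Times K) auto
  then obtain d where d: "d > 0"
    "\<And>p q. p \<in> ?Q \<Longrightarrow> q \<in> ?Q \<Longrightarrow> dist q p < d \<Longrightarrow> dist (?\<Phi> q) (?\<Phi> p) < e"
    using e unfolding uniformly_continuous_on_def by metis
  have "\<forall>\<^sub>F h in at 0. h \<noteq> 0 \<and> \<bar>h\<bar> < min a d"
    unfolding eventually_at using a d by (intro exI[of _ "min a d"]) (auto simp: dist_real_def)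
  then show ?thesis
  proof (eventually_elim, intro ballI conjI)
    fix h t assume h: "h \<noteq> 0 \<and> \<bar>h\<bar> < min a d" and t: "t \<in> K"
    show "hist_seminorm k (c t + h *\<^sub>R V t - c t) < 1 / real (Suc k)"
      by (rule ball) (use h t in auto)
    let ?p = "\<lambda>s. c t + (s * h) *\<^sub>R V t"
    \<comment> \<open>With the linear part subtracted, the derivative in \<open>s\<close> is
      \<open>h\<close> times a difference of two values of \<open>?\<Phi>\<close>, at
      \<open>(s * h, t)\<close> and \<open>(0, t)\<close>, which is smaller than
      \<open>e\<close>.\<close>
    let ?f = "\<lambda>s. g (?p s) - (s * h) *\<^sub>R dir_deriv g (c t) (V t)"
    have sh: "\<bar>s * h\<bar> \<le> \<bar>h\<bar>" if "0 \<le> s" "s \<le> 1" for s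
      using that by (simp add: abs_mult mult_left_le_one_le)
    have D: "(?f has_vector_derivative h *\<^sub>R (dir_deriv g (?p s) (V t) - dir_deriv g (c t) (V t))) (at s)"
      if s: "0 \<le> s" "s \<le> 1" for s
    proof -
      have X: "?p s \<in> X" using inX[OF _ t, of "s * h"] sh[OF s] h by auto
      have "((\<lambda>s. g (?p s)) has_vector_derivative dir_deriv g (c t + s *\<^sub>R (h *\<^sub>R V t)) (h *\<^sub>R V t)) (at s)"
        using has_dir_deriv_line[OF C1_MB_has_dir_deriv[OF g], of "c t" s "h *\<^sub>R V t"] X by simp
      then have "((\<lambda>s. g (?p s)) has_vector_derivative h *\<^sub>R dir_deriv g (?p s) (V t)) (at s)"
        using X by (simp add: C1_MB_dir_deriv_scaleR[OF g])
      moreover have "((\<lambda>s. (s * h) *\<^sub>R dir_deriv g (c t) (V t)) has_vector_derivative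
          h *\<^sub>R dir_deriv g (c t) (V t)) (at s)"
        by (auto intro!: derivative_eq_intros simp: has_vector_derivative_def)
      ultimately show ?thesis
        unfolding scaleR_diff_right by (rule has_vector_derivative_diff)
    qed
    have "norm (?f 1 - ?f 0) \<le> \<bar>h\<bar> * e * 1 - \<bar>h\<bar> * e * 0"
    proof (rule differentiable_bound_general[where \<phi>' = "\<lambda>_. \<bar>h\<bar> * e"])
      show "continuous_on {0..1} ?f"
        using D by (intro continuous_at_imp_continuous_on ballI has_vector_derivative_continuous) auto
      show "((*) (\<bar>h\<bar> * e) has_vector_derivative \<bar>h\<bar> * e) (at s)" for s
        by (auto intro!: derivative_eq_intros simp flip: has_real_derivative_iff_has_vector_derivative)
      fix s :: real assume s: "0 < s" "s < 1"
      then show "(?f has_vector_derivative h *\<^sub>R (dir_deriv g (?p s) (V t) - dir_deriv g (c t) (V t))) (at s)"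
        by (intro D) auto
      have "dist (?\<Phi> (s * h, t)) (?\<Phi> (0, t)) < e"
        by (rule d(2)) (use sh[of s] s h t a in \<open>auto simp: dist_Pair_Pair dist_real_def\<close>)
      then show "norm (h *\<^sub>R (dir_deriv g (?p s) (V t) - dir_deriv g (c t) (V t))) \<le> \<bar>h\<bar> * e"
        by (auto simp: dist_norm intro!: mult_left_mono)
    qed (auto intro!: continuous_intros)
    then show "norm (g (c t + h *\<^sub>R V t) - g (c t) - h *\<^sub>R dir_deriv g (c t) (V t)) \<le> \<bar>h\<bar> * e"
      by (simp add: algebra_simps)
  qed
qed

section \<open>Solutions and the semiflow\<close>

text \<open>Pointwise projection onto a closed ball is nonexpansive, hence nonexpansive in every
  seminorm. The absolute value keeps the ball nonempty for all \<open>r\<close>, which makes the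
  projection continuous.\<close>

lift_definition hist_clip :: "real \<Rightarrow> 'n::finite hist \<Rightarrow> 'n hist"
  is "\<lambda>r \<phi> t. closest_point (cball 0 \<bar>r\<bar>) (\<phi> t)"
  by (auto intro!: continuous_on_compose2[OF continuous_on_closest_point])

lemma hist_seminorm_clip_le: "0 \<le> r \<Longrightarrow> hist_seminorm j (hist_clip r \<phi>) \<le> r"
  using closest_point_in_set[of "cball 0 r :: (real ^ 'n) set"]
  by (intro hist_seminorm_le) (auto simp: hist_clip.rep_eq)

lemma hist_seminorm_clip_diff_le:
  "hist_seminorm j (hist_clip r \<phi> - hist_clip r \<psi>) \<le> hist_seminorm j (\<phi> - \<psi>)"
proof (rule hist_seminorm_le)
  fix t assume t: "- real j \<le> t" "t \<le> 0"
  have "norm (hist_apply (hist_clip r \<phi> - hist_clip r \<psi>) t) \<le> norm (hist_apply (\<phi> - \<psi>) t)"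
    using closest_point_lipschitz[of "cball 0 \<bar>r\<bar>" "hist_apply \<phi> t" "hist_apply \<psi> t"]
    by (simp add: minus_hist.rep_eq hist_clip.rep_eq dist_norm)
  with norm_le_hist_seminorm[OF t, of "\<phi> - \<psi>"]
  show "norm (hist_apply (hist_clip r \<phi> - hist_clip r \<psi>) t) \<le> hist_seminorm j (\<phi> - \<psi>)" by linarith
qed

text \<open>Only this seminorm of the difference vanishes: before \<open>- real j\<close> the
  history may leave the ball and be changed by the projection.\<close>

lemma hist_seminorm_clip_self:
  assumes "hist_seminorm j \<phi> \<le> r"
  shows "hist_seminorm j (hist_clip r \<phi> - \<phi>) = 0"
proof (rule antisym[OF hist_seminorm_le hist_seminorm_nonneg])
  fix t assume t: "- real j \<le> t" "t \<le> 0"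
  have "norm (hist_apply \<phi> t) \<le> \<bar>r\<bar>" using norm_le_hist_seminorm[OF t, of \<phi>] assms by linarith
  then show "norm (hist_apply (hist_clip r \<phi> - \<phi>) t) \<le> 0"
    by (simp add: minus_hist.rep_eq hist_clip.rep_eq closest_point_self)
qed

lemma continuous_on_hist_clip:
  fixes g :: "'b::topological_space \<Rightarrow> 'n::finite hist"
  assumes "continuous_on A g"
  shows "continuous_on A (\<lambda>x. hist_clip r (g x))"
  unfolding continuous_on_def
proof
  fix x assume "x \<in> A"
  with assms have "(g \<longlongrightarrow> g x) (at x within A)" by (simp add: continuous_on_def)
  then show "((\<lambda>x. hist_clip r (g x)) \<longlongrightarrow> hist_clip r (g x)) (at x within A)"
    by (rule tendsto_hist_bound[OF hist_seminorm_clip_diff_le tendsto_histD])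
qed

text \<open>Clipping the deviation from the curve \<open>c\<close> makes the right-hand side globally Lipschitz; it is
  unchanged as long as the deviation stays small on the interval that the \<open>k\<close>-th seminorm sees.\<close>

lemma clipped_solution_exists:
  fixes f :: "'n::finite hist \<Rightarrow> real ^ 'n" and c :: "real \<Rightarrow> 'n hist"
  assumes f: "C1_MB U f" and T: "0 \<le> T" and c: "continuous_on {0..T} c"
    and near: "\<And>t. t \<in> {0..T} \<Longrightarrow> dir_bounded_near f U k (c t)"
    and r: "0 \<le> r" "r < 1 / real (Suc k)"
  obtains y y' where "continuous_on UNIV y" "\<And>s. s \<le> 0 \<Longrightarrow> y s = hist_apply \<psi> s"
    "\<And>t. t \<in> {0..T} \<Longrightarrow> (y has_vector_derivative y' t) (at t within {0..T})"
    "\<And>t. t \<in> {0..T} \<Longrightarrow> norm (y' t - f (c t)) \<le> real k * hist_seminorm k (seg y t - c t)"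
    "\<And>t. t \<in> {0..T} \<Longrightarrow> hist_seminorm k (seg y t - c t) \<le> r \<Longrightarrow> seg y t \<in> U \<and> y' t = f (seg y t)"
proof -
  define F where "F t w = f (c t + hist_clip r (w - c t))" for t w
  have near': "hist_seminorm k (c t + hist_clip r w - c t) < 1 / real (Suc k)" for t w
    using hist_seminorm_clip_le[OF r(1), of k w] r(2) by simp
  have lip: "norm (f u - f w) \<le> real k * hist_seminorm k (u - w)"
    if "t \<in> {0..T}" "hist_seminorm k (u - c t) < 1 / real (Suc k)"
      "hist_seminorm k (w - c t) < 1 / real (Suc k)" for t u w
    by (rule dir_bounded_near_lipschitz[OF f near]) (use that in auto)
  have inU: "u \<in> U" if "t \<in> {0..T}" "hist_seminorm k (u - c t) < 1 / real (Suc k)" for t u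
    using near[OF that(1)] that(2) by (auto simp: dir_bounded_near_def)
  have Fc: "continuous_on {0..T} (\<lambda>t. F t (seg y t))" if "continuous_on UNIV y" for y
  proof -
    have "continuous_on {0..T} (seg y)"
      by (rule continuous_on_subset[OF continuous_on_seg[of T]])
        (auto intro: continuous_on_subset[OF that])
    then have *: "continuous_on {0..T} (\<lambda>t. c t + hist_clip r (seg y t - c t))"
      by (intro continuous_on_add c continuous_on_hist_clip continuous_on_diff)
    have "continuous_on U f" using f by (simp add: C1_MB_def)
    from continuous_on_compose2[OF this *] show ?thesis
      unfolding F_def using near' inU by blast
  qed
  have Fl: "norm (F t w - F t w') \<le> real k * hist_seminorm k (w - w')" if t: "t \<in> {0..T}" for t w w'
  proof -
    have "norm (F t w - F t w') \<le> real k * hist_seminorm k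
        (c t + hist_clip r (w - c t) - (c t + hist_clip r (w' - c t)))"
      unfolding F_def by (rule lip[OF t near' near'])
    also have "\<dots> \<le> real k * hist_seminorm k (w - w')"
      using hist_seminorm_clip_diff_le[of k r "w - c t" "w' - c t"] by (intro mult_left_mono) auto
    finally show ?thesis .
  qed
  obtain y where y: "continuous_on UNIV y" "\<And>s. s \<le> 0 \<Longrightarrow> y s = hist_apply \<psi> s"
    "\<And>t. t \<in> {0..T} \<Longrightarrow> (y has_vector_derivative F t (seg y t)) (at t within {0..T})"
    by (rule functional_ode_exists[OF T of_nat_0_le_iff Fc Fl, of \<psi>]; use that in blast)
  have clip0: "hist_seminorm k (hist_clip r w) \<le> hist_seminorm k w" for w :: "'n hist"
  proof -
    have "hist_clip r 0 = (0 :: 'n hist)"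
      using r by (intro hist_eqI) (simp add: hist_clip.rep_eq zero_hist.rep_eq closest_point_self)
    then show ?thesis using hist_seminorm_clip_diff_le[of k r w 0] by simp
  qed
  show ?thesis
  proof
    fix t assume t: "t \<in> {0..T}"
    \<comment> \<open>This estimate holds whether or not the clipping is active, so it can be used
      in Gronwall's estimate before closeness to the curve is known.\<close>
    have "norm (F t (seg y t) - f (c t)) \<le> real k * hist_seminorm k (hist_clip r (seg y t - c t))"
      using lip[OF t near', of "c t"] by (simp add: F_def)
    also have "\<dots> \<le> real k * hist_seminorm k (seg y t - c t)"
      by (intro mult_left_mono clip0) auto
    finally show "norm (F t (seg y t) - f (c t)) \<le> real k * hist_seminorm k (seg y t - c t)" .
    assume s: "hist_seminorm k (seg y t - c t) \<le> r"
    have n: "hist_seminorm k (seg y t - c t) < 1 / real (Suc k)" using s r by linarith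
    \<comment> \<open>Clipping may still alter the remote past, but \<open>f\<close> is Lipschitz in
      the \<open>k\<close>-th seminorm and does not see it.\<close>
    have "norm (F t (seg y t) - f (seg y t)) \<le>
        real k * hist_seminorm k (hist_clip r (seg y t - c t) - (seg y t - c t))"
      using lip[OF t near' n] by (simp add: F_def algebra_simps)
    then show "seg y t \<in> U \<and> F t (seg y t) = f (seg y t)"
      using inU[OF t n] hist_seminorm_clip_self[OF s] by simp
  qed (fact y)+
qed

section \<open>Uniqueness and local existence of solutions\<close>

lemma is_solution_subset:
  assumes "is_solution f U I x" "J \<subseteq> I"
  shows "is_solution f U J x"
  unfolding is_solution_def
proof (intro conjI ballI)
  show "continuous_on {s + t |s t. s \<le> 0 \<and> t \<in> J} x"
    by (rule continuous_on_subset[of "{s + t |s t. s \<le> 0 \<and> t \<in> I}"])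
      (use assms in \<open>auto simp: is_solution_def\<close>)
qed (use assms in \<open>auto simp: is_solution_def intro: has_vector_derivative_within_subset\<close>)

lemma is_solution_Icc_iff:
  assumes "0 \<le> T"
  shows "is_solution f U {0..T} x \<longleftrightarrow> continuous_on {..T} x \<and>
    (\<forall>t\<in>{0..T}. seg x t \<in> U \<and> (x has_vector_derivative f (seg x t)) (at t within {0..T}))"
proof -
  have "{s + t |s t. s \<le> 0 \<and> t \<in> {0..T}} = {..T}"
  proof (intro set_eqI iffI)
    fix r assume "r \<in> {..T}"
    then have "r = (r - T) + T \<and> r - T \<le> 0 \<and> T \<in> {0..T}" using assms by simp
    then show "r \<in> {s + t |s t. s \<le> 0 \<and> t \<in> {0..T}}" by blast
  qed auto
  then show ?thesis unfolding is_solution_def by auto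
qed

lemma solution_near_orbit:
  assumes f: "C1_MB U f" and T: "0 \<le> T" and x: "is_solution f U {0..T} x"
  obtains k where "\<And>t. t \<in> {0..T} \<Longrightarrow> dir_bounded_near f U k (seg x t)"
proof -
  have "continuous_on {0..T} (seg x)"
    by (rule continuous_on_subset[OF continuous_on_seg[of T]])
      (use x T in \<open>auto simp: is_solution_Icc_iff\<close>)
  then show ?thesis
    using x T that by (elim C1_MB_dir_bounded_near_compact[OF f compact_Icc, rotated 2])
      (auto simp: is_solution_Icc_iff)
qed

text \<open>Gronwall's estimate with no inhomogeneity. It asks for a positive bound on the initial
  deviation, which here is 0; so arbitrarily small bounds are used, and then \<open>e\<close> tends
  to 0.\<close>

lemma solution_unique:
  fixes f :: "'n::finite hist \<Rightarrow> real ^ 'n"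
  assumes f: "C1_MB U f" and T: "0 \<le> T" and x: "is_solution f U {0..T} x"
    and y: "is_solution f U {0..T} y" and init: "seg x 0 = seg y 0" and s: "s \<le> T"
  shows "x s = y s"
proof -
  obtain k where k: "\<And>t. t \<in> {0..T} \<Longrightarrow> dir_bounded_near f U k (seg x t)"
    using solution_near_orbit[OF f T x] by metis
  have x': "continuous_on {..T} x" "\<And>t. t \<in> {0..T} \<Longrightarrow> (x has_vector_derivative f (seg x t)) (at t within {0..T})"
    and y': "continuous_on {..T} y" "\<And>t. t \<in> {0..T} \<Longrightarrow> (y has_vector_derivative f (seg y t)) (at t within {0..T})"
    using x y T by (auto simp: is_solution_Icc_iff)
  have cx: "continuous_on {..t} x" "continuous_on {..t} y" if "t \<le> T" for t
    using that by (auto intro: continuous_on_subset[OF x'(1)] continuous_on_subset[OF y'(1)])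
  have past: "x r = y r" if "r \<le> 0" for r
    using init hist_apply_seg[OF cx(1)[OF T] that] hist_apply_seg[OF cx(2)[OF T] that] by simp
  show ?thesis
  proof (cases "s \<le> 0")
    case False
    define r where "r = 1 / (2 * real (Suc k))"
    have r: "0 < r" "r < 1 / real (Suc k)" by (auto simp: r_def divide_simps)
    have "norm (y s - x s) \<le> e" if e: "0 < e" for e
    proof -
      define a where "a = min e r"
      have a: "0 < a" using e r by (simp add: a_def)
      \<comment> \<open>The initial bound is \<open>a\<close> divided by the full growth factor, so
        the deviation stays below \<open>a\<close> up to \<open>T\<close>; \<open>a\<close> \<le>
        \<open>r\<close> keeps \<open>y\<close> where \<open>f\<close> is Lipschitz, and
        \<open>a\<close> \<le> \<open>e\<close> gives the claim.\<close>
      have "norm (y s - x s) < a * exp (- ((real k + 1) * T)) * exp ((real k + 1) * s)"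
      proof (rule norm_less_exp_delay[where d = "\<lambda>t. y t - x t" and d' = "\<lambda>t. f (seg y t) - f (seg x t)"
            and j = "real k" and \<delta> = r and \<epsilon> = 0])
        show "continuous_on {0..T} (\<lambda>t. y t - x t)"
          by (intro continuous_on_diff continuous_on_subset[OF x'(1)] continuous_on_subset[OF y'(1)]) auto
        show "((\<lambda>t. y t - x t) has_vector_derivative f (seg y t) - f (seg x t)) (at t within {0..T})"
          if "t \<in> {0..T}" for t
          by (intro has_vector_derivative_diff x' y' that)
        show "norm (y t - x t) < a * exp (- ((real k + 1) * T))" if "t \<le> 0" for t
          using past[OF that] a by simp
        show "a * exp (- ((real k + 1) * T)) * exp ((real k + 1) * T) \<le> r"
          by (simp add: a_def mult.assoc flip: exp_add)
        fix t M assume t: "t \<in> {0..T}" and M: "M \<le> r"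
          "\<And>s. t - real k \<le> s \<Longrightarrow> s \<le> t \<Longrightarrow> norm (y s - x s) \<le> M"
        have "hist_seminorm k (seg y t - seg x t) \<le> M"
          by (intro hist_seminorm_seg_diff_le cx M) (use t in auto)
        moreover from this have "norm (f (seg y t) - f (seg x t)) \<le> real k * hist_seminorm k (seg y t - seg x t)"
          by (intro dir_bounded_near_lipschitz[OF f k]) (use t M r in auto)
        ultimately show "norm (f (seg y t) - f (seg x t)) \<le> real k * M + 0"
          using mult_left_mono[of "hist_seminorm k (seg y t - seg x t)" M "real k"] by simp
      qed (use a False s in auto)
      also have "\<dots> = a * exp ((real k + 1) * (s - T))" by (simp add: algebra_simps flip: exp_add)
      also have "\<dots> \<le> a * 1" using a s by (intro mult_left_mono) (auto simp: mult_nonneg_nonpos)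
      also have "a * 1 \<le> e" by (simp add: a_def)
      finally show ?thesis by simp
    qed
    then have "norm (y s - x s) \<le> 0" by (rule field_le_epsilon[of _ 0, simplified])
    then show ?thesis by simp
  qed (rule past)
qed

text \<open>The clipped equation is taken around the constant curve \<psi>. Its solution starts at
  \<psi>, so by continuity of the segments the clipping is inactive for a short time.\<close>

lemma solution_exists:
  fixes f :: "'n::finite hist \<Rightarrow> real ^ 'n"
  assumes f: "C1_MB U f" and \<psi>: "\<psi> \<in> U"
  obtains T x where "0 < T" "is_solution f U {0..T} x" "seg x 0 = \<psi>"
proof -
  obtain k where k: "dir_bounded_near f U k \<psi>"
    using C1_MB_dir_bounded_near_compact[OF f, of "{0::real}" "\<lambda>_. \<psi>"] \<psi> by auto
  define r where "r = 1 / (2 * real (Suc k))"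
  have r: "0 < r" "r < 1 / real (Suc k)" by (auto simp: r_def divide_simps)
  obtain y y' where y: "continuous_on UNIV y" "\<And>s. s \<le> 0 \<Longrightarrow> y s = hist_apply \<psi> s"
    "\<And>t. t \<in> {0..1} \<Longrightarrow> (y has_vector_derivative y' t) (at t within {0..1})"
    "\<And>t. t \<in> {0..1} \<Longrightarrow> hist_seminorm k (seg y t - \<psi>) \<le> r \<Longrightarrow> seg y t \<in> U \<and> y' t = f (seg y t)"
    by (rule clipped_solution_exists[OF f zero_le_one continuous_on_const k less_imp_le[OF r(1)] r(2), of \<psi>])
      (use that in blast)
  have y0: "seg y 0 = \<psi>" using y(2) by (rule seg_hist_apply)
  have "continuous_on {..1} (seg y)"
    by (intro continuous_on_seg continuous_on_subset[OF y(1)]) auto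
  then have "(seg y \<longlongrightarrow> \<psi>) (at 0 within {..1})" using y0 by (auto simp: continuous_on_def)
  from tendsto_histD[OF this, of k]
  have "\<forall>\<^sub>F t in at 0 within {..1}. hist_seminorm k (seg y t - \<psi>) < r"
    using r(1) by (rule order_tendstoD(2))
  then obtain d where d: "d > 0" "\<And>t. t \<le> 1 \<Longrightarrow> t \<noteq> 0 \<Longrightarrow> \<bar>t\<bar> < d \<Longrightarrow> hist_seminorm k (seg y t - \<psi>) < r"
    unfolding eventually_at by (auto simp: dist_real_def)
  define T where "T = min (d/2) 1"
  have T: "0 < T" "T \<le> 1" "T < d" using d by (auto simp: T_def)
  have "hist_seminorm k (seg y t - \<psi>) \<le> r" if "t \<in> {0..T}" for t
    using d(2)[of t] that T r y0 by (cases "t = 0") auto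
  then have "seg y t \<in> U \<and> y' t = f (seg y t)" if "t \<in> {0..T}" for t
    using y(4)[of t] that T by auto
  moreover have "(y has_vector_derivative y' t) (at t within {0..T})" if "t \<in> {0..T}" for t
    by (rule has_vector_derivative_within_subset[OF y(3)]) (use that T in auto)
  ultimately have "is_solution f U {0..T} y"
    using T by (auto simp: is_solution_Icc_iff intro: continuous_on_subset[OF y(1)])
  with T(1) y0 show ?thesis using that by blast
qed

section \<open>Maximal solutions and the semiflow\<close>

lemma less_exit_timeD:
  assumes "ereal t < exit_time f U \<phi>"
  obtains T x where "t < T" "0 < T" "ereal T \<le> exit_time f U \<phi>" "is_solution f U {0..T} x" "seg x 0 = \<phi>"
proof -
  from assms obtain T x where "t < T" "0 < T" "is_solution f U {0..T} x" "seg x 0 = \<phi>"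
    unfolding exit_time_def less_Sup_iff by auto
  moreover from this have "ereal T \<le> exit_time f U \<phi>"
    unfolding exit_time_def by (intro Sup_upper) blast
  ultimately show ?thesis using that by blast
qed

lemma solution_le_exit_time:
  "0 < T \<Longrightarrow> is_solution f U {0..T} x \<Longrightarrow> ereal T \<le> exit_time f U (seg x 0)"
  unfolding exit_time_def by (intro Sup_upper) blast

lemma at_within_exit_interval:
  assumes "ereal T \<le> e" "0 \<le> t" "t < T"
  shows "at t within {s. 0 \<le> s \<and> ereal s < e} = at t within {0..T}"
proof (rule at_within_nhd[of _ "{..<T}"])
  have "ereal s < e" if "s < T" for s
    using that assms(1) by (metis less_ereal.simps(1) less_le_trans)
  then show "{s. 0 \<le> s \<and> ereal s < e} \<inter> {..<T} - {t} = {0..T} \<inter> {..<T} - {t}" by auto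
qed (use assms in auto)

text \<open>The supremum provides for each time a solution reaching beyond it. By uniqueness these
  agree on overlaps, and their diagonal is a solution on the whole interval, which justifies the
  choice made in \<open>max_solution\<close>.\<close>

lemma max_solution_is_solution:
  fixes f :: "'n::finite hist \<Rightarrow> real ^ 'n"
  assumes f: "C1_MB U f" and pos: "0 < exit_time f U \<phi>"
  shows "is_solution f U {t. 0 \<le> t \<and> ereal t < exit_time f U \<phi>} (max_solution f U \<phi>)"
    and "seg (max_solution f U \<phi>) 0 = \<phi>"
proof -
  let ?e = "exit_time f U \<phi>" and ?I = "{t. 0 \<le> t \<and> ereal t < exit_time f U \<phi>}"
  have "\<forall>t. \<exists>T x. ereal t < ?e \<longrightarrow> t < T \<and> 0 < T \<and> ereal T \<le> ?e \<and> is_solution f U {0..T} x \<and> seg x 0 = \<phi>"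
    by (metis less_exit_timeD)
  then obtain T z where z: "\<And>t. ereal t < ?e \<Longrightarrow> t < T t \<and> 0 < T t \<and> ereal (T t) \<le> ?e \<and>
      is_solution f U {0..T t} (z t) \<and> seg (z t) 0 = \<phi>" by metis
  define X where "X t = z t t" for t
  have X: "X s = z t s" if t: "ereal t < ?e" and s: "s < T t" for s t
  proof -
    have se: "ereal s < ?e" using z[OF t] s by (metis less_ereal.simps(1) less_le_trans)
    let ?m = "min (T s) (T t)"
    show ?thesis unfolding X_def
      by (rule solution_unique[OF f, of ?m])
        (use z[OF t] z[OF se] s in \<open>auto intro: is_solution_subset\<close>)
  qed
  have cz: "continuous_on {..<T t} (z t)" if "ereal t < ?e" for t
    by (rule continuous_on_subset[of "{..T t}"]) (use z[OF that] in \<open>auto simp: is_solution_Icc_iff\<close>)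
  have "is_solution f U ?I X"
    unfolding is_solution_def
  proof (intro conjI ballI continuous_at_imp_continuous_on)
    fix r assume "r \<in> {s + t |s t. s \<le> 0 \<and> t \<in> ?I}"
    then obtain s t where "r = s + t" "s \<le> 0" "t \<in> ?I" by blast
    then have t: "r \<le> t" "0 \<le> t" "ereal t < ?e" by auto
    have "continuous_on {..<T t} X"
      using cz[OF t(3)] X[OF t(3)] by (metis continuous_on_cong lessThan_iff)
    then show "isCont X r"
      using z[OF t(3)] t by (intro continuous_on_interior[of "{..<T t}"]) (auto simp: interior_open)
  next
    fix t assume "t \<in> ?I"
    then have t: "0 \<le> t" "ereal t < ?e" by auto
    note zt = z[OF t(2)]
    have zs: "seg (z t) t \<in> U" "(z t has_vector_derivative f (seg (z t) t)) (at t within {0..T t})"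
      using zt t by (auto simp: is_solution_Icc_iff)
    have sX: "seg X t = seg (z t) t" by (rule seg_eqI) (use X[OF t(2)] zt in auto)
    show "seg X t \<in> U" using zs sX by simp
    have "(z t has_vector_derivative f (seg X t)) (at t within ?I)"
      using zs zt t sX by (subst at_within_exit_interval[of "T t"]) auto
    then show "(X has_vector_derivative f (seg X t)) (at t within ?I)"
      by (rule has_vector_derivative_transform_within[where d = "T t - t"])
        (use zt t X[OF t(2)] in \<open>auto simp: dist_real_def\<close>)
  qed
  moreover have "seg X 0 = \<phi>"
  proof -
    have 0: "ereal 0 < ?e" using pos by (simp add: zero_ereal_def)
    have "seg X 0 = seg (z 0) 0" by (rule seg_eqI) (use X[OF 0] z[OF 0] in auto)
    then show ?thesis using z[OF 0] by simp
  qed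
  ultimately have "is_solution f U ?I (max_solution f U \<phi>) \<and> seg (max_solution f U \<phi>) 0 = \<phi>"
    unfolding max_solution_def by (intro someI[of "\<lambda>x. is_solution f U ?I x \<and> seg x 0 = \<phi>"]) auto
  then show "is_solution f U ?I (max_solution f U \<phi>)" "seg (max_solution f U \<phi>) 0 = \<phi>" by auto
qed

text \<open>Any solution at hand computes the semiflow, which removes the choice operator from later
  arguments. The inequality \<open>t < T\<close> is strict because \<open>T\<close> \<le>
  \<open>exit_time\<close> places only the times before \<open>T\<close> in the domain of the
  maximal solution.\<close>

lemma semiflow_eq_seg:
  fixes f :: "'n::finite hist \<Rightarrow> real ^ 'n"
  assumes f: "C1_MB U f" and x: "is_solution f U {0..T} x" and t: "0 \<le> t" "t < T"
  shows "semiflow f U t (seg x 0) = seg x t"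
proof -
  let ?e = "exit_time f U (seg x 0)" and ?x = "max_solution f U (seg x 0)"
  have e: "ereal T \<le> ?e" using x t by (intro solution_le_exit_time) auto
  have te: "ereal t < ?e" using e t by (metis less_ereal.simps(1) less_le_trans)
  then have pos: "0 < ?e" using t by (metis ereal_less_eq(3) le_less_trans zero_ereal_def)
  have "is_solution f U {0..t} ?x"
  proof (rule is_solution_subset[OF max_solution_is_solution(1)[OF f pos]], intro subsetI CollectI conjI)
    fix s assume "s \<in> {0..t}"
    then show "0 \<le> s" "ereal s < ?e" using te by (auto intro: le_less_trans[OF _ te])
  qed
  then have "?x s = x s" if "s \<le> t" for s
    using solution_unique[OF f t(1) _ is_solution_subset[OF x]] max_solution_is_solution(2)[OF f pos] t that
    by auto
  then show ?thesis unfolding semiflow_def by (rule seg_eqI)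
qed

section \<open>The variational equation\<close>

text \<open>Two Gronwall estimates: the first keeps the perturbed clipped solution so close to \<open>x\<close> that
  clipping has no effect; the second compares it with the first order approximation.\<close>

lemma perturbed_solution_first_order:
  fixes f :: "'n::finite hist \<Rightarrow> real ^ 'n"
  assumes f: "C1_MB U f" and T: "0 \<le> T" and x: "is_solution f U {0..T} x"
    and V: "continuous_on UNIV V" "\<And>s. s \<le> 0 \<Longrightarrow> V s = hist_apply \<phi>' s"
      "\<And>t. t \<in> {0..T} \<Longrightarrow> (V has_vector_derivative dir_deriv f (seg x t) (seg V t)) (at t within {0..T})"
    and e: "0 < e"
  shows "\<forall>\<^sub>F h in at 0. \<exists>y. is_solution f U {0..T} y \<and> seg y 0 = seg x 0 + h *\<^sub>R \<phi>' \<and>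
    (\<forall>s\<le>T. norm (y s - x s - h *\<^sub>R V s) \<le> \<bar>h\<bar> * e)"
proof -
  obtain k where k: "\<And>t. t \<in> {0..T} \<Longrightarrow> dir_bounded_near f U k (seg x t)"
    using solution_near_orbit[OF f T x] by metis
  have x': "continuous_on {..T} x" "\<And>t. t \<in> {0..T} \<Longrightarrow> seg x t \<in> U"
    "\<And>t. t \<in> {0..T} \<Longrightarrow> (x has_vector_derivative f (seg x t)) (at t within {0..T})"
    using x T by (auto simp: is_solution_Icc_iff)
  have cx: "continuous_on {..t} x" if "t \<le> T" for t
    using that by (auto intro: continuous_on_subset[OF x'(1)])
  have cV: "continuous_on A V" for A by (rule continuous_on_subset[OF V(1)]) simp
  have segx: "continuous_on {0..T} (seg x)" and segV: "continuous_on {0..T} (seg V)"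
    by (rule continuous_on_subset[OF continuous_on_seg[of T]], use x'(1) cV in auto)+
  define r where "r = 1 / (2 * real (Suc k))"
  have r: "0 < r" "r < 1 / real (Suc k)" by (auto simp: r_def divide_simps)
  \<comment> \<open>The growth factor of both Gronwall estimates. Accordingly \<open>h\<close> is
    restricted so that \<bar>h\<bar> N E \<le> r, and the remainder is requested with tolerance
    \<open>e / E\<close>.\<close>
  define E where "E = exp ((real k + 1) * T)"
  have E: "E > 0" by (simp add: E_def)
  \<comment> \<open>The summand 1 makes the bound \<bar>h\<bar> N on the initial deviation
    strict.\<close>
  define N where "N = hist_seminorm k \<phi>' + 1"
  have N: "N > 0" using hist_seminorm_nonneg[of k \<phi>'] by (simp add: N_def)
  have "\<forall>\<^sub>F h in at 0. h \<noteq> 0 \<and> \<bar>h\<bar> < r / (N * E)"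
    unfolding eventually_at using r N E by (intro exI[of _ "r / (N * E)"]) (auto simp: dist_real_def)
  moreover have "\<forall>\<^sub>F h in at 0. \<forall>t\<in>{0..T}.
      hist_seminorm k (seg x t + h *\<^sub>R seg V t - seg x t) < 1 / real (Suc k) \<and>
      norm (f (seg x t + h *\<^sub>R seg V t) - f (seg x t) - h *\<^sub>R dir_deriv f (seg x t) (seg V t)) \<le> \<bar>h\<bar> * (e / E)"
    by (rule C1_MB_remainder_uniform[OF f compact_Icc segx segV k]) (use e E in auto)
  ultimately show ?thesis
  proof eventually_elim
    case (elim h)
    have near: "hist_seminorm k (seg x t + h *\<^sub>R seg V t - seg x t) < 1 / real (Suc k)"
      and rem: "norm (f (seg x t + h *\<^sub>R seg V t) - f (seg x t) - h *\<^sub>R dir_deriv f (seg x t) (seg V t)) \<le> \<bar>h\<bar> * (e / E)"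
      if "t \<in> {0..T}" for t
      using elim(2) that by auto
    have h: "h \<noteq> 0" "\<bar>h\<bar> * N * E \<le> r" using elim(1) N E by (auto simp: field_simps)
    obtain y y' where y: "continuous_on UNIV y" "\<And>s. s \<le> 0 \<Longrightarrow> y s = hist_apply (seg x 0 + h *\<^sub>R \<phi>') s"
      "\<And>t. t \<in> {0..T} \<Longrightarrow> (y has_vector_derivative y' t) (at t within {0..T})"
      "\<And>t. t \<in> {0..T} \<Longrightarrow> norm (y' t - f (seg x t)) \<le> real k * hist_seminorm k (seg y t - seg x t)"
      "\<And>t. t \<in> {0..T} \<Longrightarrow> hist_seminorm k (seg y t - seg x t) \<le> r \<Longrightarrow> seg y t \<in> U \<and> y' t = f (seg y t)"
      using clipped_solution_exists[OF f T segx k less_imp_le[OF r(1)] r(2), of "seg x 0 + h *\<^sub>R \<phi>'"] by blast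
    have cy: "continuous_on A y" for A by (rule continuous_on_subset[OF y(1)]) simp
    have past: "y s - x s = h *\<^sub>R hist_apply \<phi>' s" if "s \<le> 0" for s
      using y(2)[OF that] that cx[of 0] T by (simp add: plus_hist.rep_eq scaleR_hist.rep_eq hist_apply_seg)
    have init: "norm (y s - x s) < \<bar>h\<bar> * N" if "- real k \<le> s" "s \<le> 0" for s
      using past[OF that(2)] norm_le_hist_seminorm[OF that, of \<phi>'] h by (simp add: N_def)
    have segdiff: "hist_seminorm k (seg y t - seg x t) \<le> M"
      if "t \<le> T" "\<And>s. t - real k \<le> s \<Longrightarrow> s \<le> t \<Longrightarrow> norm (y s - x s) \<le> M" for t M
      by (intro hist_seminorm_seg_diff_le cx cy that)
    have "norm (y t - x t) < \<bar>h\<bar> * N * exp ((real k + 1) * t)" if t: "t \<in> {0..T}" for t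
    proof (rule norm_less_exp_delay[where d = "\<lambda>t. y t - x t" and d' = "\<lambda>t. y' t - f (seg x t)"
          and j = "real k" and \<delta> = r and \<epsilon> = 0])
      show "continuous_on {0..T} (\<lambda>t. y t - x t)"
        by (intro continuous_on_diff cy continuous_on_subset[OF x'(1)]) auto
      show "((\<lambda>t. y t - x t) has_vector_derivative y' t - f (seg x t)) (at t within {0..T})"
        if "t \<in> {0..T}" for t
        by (intro has_vector_derivative_diff x' y that)
      show "norm (y' t - f (seg x t)) \<le> real k * M + 0" if "t \<in> {0..T}"
        "\<And>s. t - real k \<le> s \<Longrightarrow> s \<le> t \<Longrightarrow> norm (y s - x s) \<le> M" for t M
        using y(4)[OF that(1)] mult_left_mono[OF segdiff[OF _ that(2)], of t "real k"] that(1) by simp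
    qed (use init t h N E in \<open>auto simp: E_def\<close>)
    moreover have "\<bar>h\<bar> * N * exp ((real k + 1) * t) \<le> \<bar>h\<bar> * N * E" if "t \<in> {0..T}" for t
      unfolding E_def using N that by (intro mult_left_mono) (auto intro!: mult_left_mono)
    ultimately have close: "norm (y t - x t) \<le> r" if "t \<in> {0..T}" for t
      using h(2) that by (meson less_imp_le order_trans)
    \<comment> \<open>The window of the seminorm reaches into the past, where the bound is
      \<bar>h\<bar> N; since \<open>E\<close> \<ge> 1, this is also at most
      \<open>r\<close>.\<close>
    have "\<bar>h\<bar> * N * 1 \<le> \<bar>h\<bar> * N * E" using N T by (intro mult_left_mono) (auto simp: E_def)
    then have "norm (y s - x s) \<le> r" if "- real k \<le> s" "s \<le> T" for s
      using close[of s] init[of s] h(2) that by (cases "s \<le> 0") auto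
    then have close_seg: "hist_seminorm k (seg y t - seg x t) \<le> r" if "t \<in> {0..T}" for t
      using that by (intro segdiff) auto
    note y5 = y(5)[OF _ close_seg]
    have sol: "is_solution f U {0..T} y"
      using T y5 y(3) cy by (auto simp: is_solution_Icc_iff)
    have y0: "seg y 0 = seg x 0 + h *\<^sub>R \<phi>'" using y(2) by (rule seg_hist_apply)
    have d0: "y s - x s - h *\<^sub>R V s = 0" if "s \<le> 0" for s
      using past[OF that] V(2)[OF that] by simp
    have d: "norm (y t - x t - h *\<^sub>R V t) < \<bar>h\<bar> * (e / E) * exp ((real k + 1) * t)" if t: "t \<in> {0..T}" for t
    proof (rule norm_less_exp_delay[where d = "\<lambda>t. y t - x t - h *\<^sub>R V t" and j = "real k"
          and d' = "\<lambda>t. f (seg y t) - f (seg x t) - h *\<^sub>R dir_deriv f (seg x t) (seg V t)"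
          and \<epsilon> = "\<bar>h\<bar> * (e / E)"])
      show "continuous_on {0..T} (\<lambda>t. y t - x t - h *\<^sub>R V t)"
        by (intro continuous_intros cy cV continuous_on_subset[OF x'(1)]) auto
      show "((\<lambda>t. y t - x t - h *\<^sub>R V t) has_vector_derivative
          f (seg y t) - f (seg x t) - h *\<^sub>R dir_deriv f (seg x t) (seg V t)) (at t within {0..T})"
        if t: "t \<in> {0..T}" for t
      proof -
        have "((\<lambda>t. h *\<^sub>R V t) has_vector_derivative h *\<^sub>R dir_deriv f (seg x t) (seg V t)) (at t within {0..T})"
          using bounded_linear.has_vector_derivative[OF bounded_linear_scaleR_right V(3)[OF t]] .
        moreover have "(y has_vector_derivative f (seg y t)) (at t within {0..T})"
          using y(3)[OF t] y5[OF t t] by simp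
        ultimately show ?thesis by (intro has_vector_derivative_diff x'(3)[OF t])
      qed
      show "norm (y s - x s - h *\<^sub>R V s) < \<bar>h\<bar> * (e / E)" if "s \<le> 0" for s
        using d0[OF that] h e E by simp
      fix t M assume t: "t \<in> {0..T}" and M: "\<And>s. t - real k \<le> s \<Longrightarrow> s \<le> t \<Longrightarrow> norm (y s - x s - h *\<^sub>R V s) \<le> M"
      let ?u = "seg x t + h *\<^sub>R seg V t"
      have "hist_seminorm k (seg y t - ?u) \<le> M"
      proof (rule hist_seminorm_le)
        fix s assume s: "- real k \<le> s" "s \<le> 0"
        have "hist_apply (seg y t - ?u) s = y (t + s) - x (t + s) - h *\<^sub>R V (t + s)"
          using s t cx[of t] cy cV
          by (simp add: minus_hist.rep_eq plus_hist.rep_eq scaleR_hist.rep_eq hist_apply_seg)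
        then show "norm (hist_apply (seg y t - ?u) s) \<le> M" using M[of "t + s"] s by simp
      qed
      then have "real k * hist_seminorm k (seg y t - ?u) \<le> real k * M" by (intro mult_left_mono) auto
      moreover have "norm (f (seg y t) - f ?u) \<le> real k * hist_seminorm k (seg y t - ?u)"
        using near[OF t] close_seg[OF t] r(2) by (intro dir_bounded_near_lipschitz[OF f k[OF t]]) auto
      ultimately have lip: "norm (f (seg y t) - f ?u) \<le> real k * M" by linarith
      \<comment> \<open>The first bracket is Lipschitz in the deviation from the first order
        approximation \<open>?u\<close> and supplies the homogeneous term; the second is the
        linearisation remainder and supplies the inhomogeneity.\<close>
      have "f (seg y t) - f (seg x t) - h *\<^sub>R dir_deriv f (seg x t) (seg V t) =
          (f (seg y t) - f ?u) + (f ?u - f (seg x t) - h *\<^sub>R dir_deriv f (seg x t) (seg V t))" by simp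
      then show "norm (f (seg y t) - f (seg x t) - h *\<^sub>R dir_deriv f (seg x t) (seg V t)) \<le>
          real k * M + \<bar>h\<bar> * (e / E)"
        using norm_triangle_mono[OF lip rem[OF t]] by (simp only:)
    qed (use t in auto)
    have "norm (y s - x s - h *\<^sub>R V s) \<le> \<bar>h\<bar> * e" if s: "s \<le> T" for s
    proof (cases "s \<le> 0")
      case False
      then have "norm (y s - x s - h *\<^sub>R V s) \<le> \<bar>h\<bar> * (e / E) * exp ((real k + 1) * s)"
        using d[of s] s by simp
      also have "\<dots> \<le> \<bar>h\<bar> * (e / E) * E"
        unfolding E_def using e s by (intro mult_left_mono) (auto intro!: mult_left_mono)
      finally show ?thesis using E by simp
    qed (use d0 e in simp)
    with sol y0 show ?case by blast
  qed
qed

lemma semiflow_has_dir_deriv: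
  fixes f :: "'n::finite hist \<Rightarrow> real ^ 'n"
  assumes f: "C1_MB U f" and T: "0 \<le> T" and x: "is_solution f U {0..T} x"
  obtains V where "continuous_on UNIV V" "\<And>s. s \<le> 0 \<Longrightarrow> V s = hist_apply \<phi>' s"
    "\<And>t. t \<in> {0..T} \<Longrightarrow> (V has_vector_derivative dir_deriv f (seg x t) (seg V t)) (at t within {0..T})"
    "\<And>t. 0 \<le> t \<Longrightarrow> t < T \<Longrightarrow> has_dir_deriv (semiflow f U t) (seg x 0) \<phi>' (seg V t)"
proof -
  obtain k where k: "\<And>t. t \<in> {0..T} \<Longrightarrow> dir_bounded_near f U k (seg x t)"
    using solution_near_orbit[OF f T x] by metis
  have x': "continuous_on {..T} x" "\<And>t. t \<in> {0..T} \<Longrightarrow> seg x t \<in> U"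
    using x T by (auto simp: is_solution_Icc_iff)
  have c: "continuous_on {0..T} (\<lambda>t. dir_deriv f (seg x t) (seg y t))" if "continuous_on UNIV y" for y
    using x' continuous_on_subset[OF that]
    by (intro continuous_on_dir_deriv[OF f] continuous_on_subset[OF continuous_on_seg[of T]]) auto
  obtain V where V: "continuous_on UNIV V" "\<And>s. s \<le> 0 \<Longrightarrow> V s = hist_apply \<phi>' s"
    "\<And>t. t \<in> {0..T} \<Longrightarrow> (V has_vector_derivative dir_deriv f (seg x t) (seg V t)) (at t within {0..T})"
    by (rule functional_ode_exists[OF T of_nat_0_le_iff c
          dir_bounded_near_dir_deriv_lipschitz[OF f k], of \<phi>']; use that in blast)
  have "has_dir_deriv (semiflow f U t) (seg x 0) \<phi>' (seg V t)" if t: "0 \<le> t" "t < T" for t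
    unfolding has_dir_deriv_def tendsto_hist_iff
  proof (intro allI tendstoI)
    fix i and e :: real assume e: "e > 0"
    then have "\<forall>\<^sub>F h in at 0. \<exists>y. is_solution f U {0..T} y \<and> seg y 0 = seg x 0 + h *\<^sub>R \<phi>' \<and>
        (\<forall>s\<le>T. norm (y s - x s - h *\<^sub>R V s) \<le> \<bar>h\<bar> * (e / 2))"
      by (intro perturbed_solution_first_order[OF f T x V]) auto
    moreover have "\<forall>\<^sub>F h in at 0. h \<noteq> (0::real)" by (simp add: eventually_at_filter)
    ultimately show "\<forall>\<^sub>F h in at 0. dist (hist_seminorm i ((1/h) *\<^sub>R (semiflow f U t (seg x 0 + h *\<^sub>R \<phi>') -
        semiflow f U t (seg x 0)) - seg V t)) 0 < e"
    proof eventually_elim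
      case (elim h)
      then obtain y where y: "is_solution f U {0..T} y" "seg y 0 = seg x 0 + h *\<^sub>R \<phi>'"
        "\<And>s. s \<le> T \<Longrightarrow> norm (y s - x s - h *\<^sub>R V s) \<le> \<bar>h\<bar> * (e / 2)" by blast
      have eq: "semiflow f U t (seg x 0 + h *\<^sub>R \<phi>') = seg y t" "semiflow f U t (seg x 0) = seg x t"
        using semiflow_eq_seg[OF f y(1) t] semiflow_eq_seg[OF f x t] y(2) by simp_all
      have cs: "continuous_on {..t} x" "continuous_on {..t} y" "continuous_on {..t} V"
        using x' y(1) V(1) T t by (auto simp: is_solution_Icc_iff intro: continuous_on_subset)
      \<comment> \<open>The index \<open>i\<close> is arbitrary and unrelated to the delay that
        \<open>f\<close> sees: \<open>y(3)\<close> bounds the deviation at all times up to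
        \<open>T\<close>, however far back.\<close>
      have "hist_seminorm i ((1/h) *\<^sub>R (seg y t - seg x t) - seg V t) \<le> e / 2"
      proof (rule hist_seminorm_le)
        fix s assume s: "- real i \<le> s" "s \<le> 0"
        let ?z = "y (t + s) - x (t + s) - h *\<^sub>R V (t + s)"
        have z: "hist_apply ((1/h) *\<^sub>R (seg y t - seg x t) - seg V t) s = (1/h) *\<^sub>R ?z"
          using s cs elim(2) by (simp add: minus_hist.rep_eq scaleR_hist.rep_eq hist_apply_seg scaleR_diff_right)
        have "\<bar>1/h\<bar> * norm ?z \<le> \<bar>1/h\<bar> * (\<bar>h\<bar> * (e / 2))"
          by (rule mult_left_mono[OF y(3)]) (use s t in auto)
        then show "norm (hist_apply ((1/h) *\<^sub>R (seg y t - seg x t) - seg V t) s) \<le> e / 2"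
          unfolding z norm_scaleR using elim(2) by simp
      qed
      then show ?case using e by (simp add: eq hist_seminorm_nonneg)
    qed
  qed
  with V show ?thesis using that by blast
qed

section \<open>The derivative of the semiflow on the whole exit interval\<close>

theorem proposition5p2:
  fixes U :: "'n::finite hist set"
    and f :: "'n hist \<Rightarrow> real ^ 'n"
    and \<phi> \<phi>' :: "'n hist"
    and v :: "real \<Rightarrow> real ^ 'n"
  assumes "open U"
    and "C1_MB U f \<or> C1_F U f"
    and "\<phi> \<in> U"
    and "\<And>t. 0 \<le> t \<Longrightarrow> ereal t < exit_time f U \<phi> \<Longrightarrow>
           v t = hist_apply (dir_deriv (semiflow f U t) \<phi> \<phi>') 0"
    and "\<And>t. t < 0 \<Longrightarrow> v t = hist_apply \<phi>' t"
  shows "(\<forall>t. 0 \<le> t \<and> ereal t < exit_time f U \<phi> \<longrightarrow>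
            dir_differentiable (semiflow f U t) \<phi> \<phi>' \<and>
            seg v t = dir_deriv (semiflow f U t) \<phi> \<phi>') \<and>
         seg v 0 = \<phi>' \<and>
         continuous_on {t. ereal t < exit_time f U \<phi>} v \<and>
         (\<forall>t. 0 \<le> t \<and> ereal t < exit_time f U \<phi> \<longrightarrow>
            (v has_vector_derivative dir_deriv f (seg (max_solution f U \<phi>) t) (seg v t))
              (at t within {s. 0 \<le> s \<and> ereal s < exit_time f U \<phi>}))"
proof -
  let ?e = "exit_time f U \<phi>" and ?I = "{s. 0 \<le> s \<and> ereal s < exit_time f U \<phi>}"
  have f: "C1_MB U f" using assms(2) C1_F_imp_C1_MB by blast
  obtain T0 x0 where "0 < T0" "is_solution f U {0..T0} x0" "seg x0 0 = \<phi>"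
    using solution_exists[OF f assms(3)] by blast
  then have "ereal T0 \<le> ?e" "0 < ereal T0" using solution_le_exit_time by auto
  then have pos: "0 < ?e" by (rule less_le_trans[rotated])
  then have 0: "ereal 0 < ?e" by (simp add: zero_ereal_def)
  \<comment> \<open>\<open>T\<close> lies strictly beyond \<open>t\<close>, so \<open>v\<close>
    agrees with \<open>V\<close> on a neighbourhood of \<open>t\<close>; continuity and
    differentiability at \<open>t\<close> then transfer, and no global solution of the variational
    equation has to be glued together.\<close>
  have local: "\<exists>T x V. t < T \<and> 0 < T \<and> ereal T \<le> ?e \<and> is_solution f U {0..T} x \<and> seg x 0 = \<phi> \<and>
      continuous_on UNIV V \<and> (\<forall>s\<le>0. V s = hist_apply \<phi>' s) \<and> (\<forall>s<T. v s = V s) \<and>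
      (\<forall>s\<in>{0..T}. (V has_vector_derivative dir_deriv f (seg x s) (seg V s)) (at s within {0..T})) \<and>
      (\<forall>s. 0 \<le> s \<longrightarrow> s < T \<longrightarrow> has_dir_deriv (semiflow f U s) \<phi> \<phi>' (seg V s))"
    if t: "ereal t < ?e" for t
  proof -
    obtain T x where T: "t < T" "0 < T" "ereal T \<le> ?e" "is_solution f U {0..T} x" "seg x 0 = \<phi>"
      using less_exit_timeD[OF t] by metis
    obtain V where V: "continuous_on UNIV V" "\<And>s. s \<le> 0 \<Longrightarrow> V s = hist_apply \<phi>' s"
      "\<And>t. t \<in> {0..T} \<Longrightarrow> (V has_vector_derivative dir_deriv f (seg x t) (seg V t)) (at t within {0..T})"
      "\<And>t. 0 \<le> t \<Longrightarrow> t < T \<Longrightarrow> has_dir_deriv (semiflow f U t) \<phi> \<phi>' (seg V t)"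
      using semiflow_has_dir_deriv[OF f less_imp_le[OF T(2)] T(4), of \<phi>'] T(5) by metis
    have "v s = V s" if s: "s < T" for s
    proof (cases "0 \<le> s")
      case True
      have "ereal s < ?e" using s T(3) by (metis less_ereal.simps(1) less_le_trans)
      then have "v s = hist_apply (seg V s) 0"
        using assms(4)[OF True] has_dir_deriv_unique[OF V(4)[OF True s]] by simp
      also have "\<dots> = V s" using continuous_on_subset[OF V(1)] by (simp add: hist_apply_seg)
      finally show ?thesis .
    qed (use assms(5) V(2) in simp)
    with T V show ?thesis by blast
  qed
  have "dir_differentiable (semiflow f U t) \<phi> \<phi>' \<and> seg v t = dir_deriv (semiflow f U t) \<phi> \<phi>' \<and>
      (v has_vector_derivative dir_deriv f (seg (max_solution f U \<phi>) t) (seg v t)) (at t within ?I)"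
    if t: "0 \<le> t" "ereal t < ?e" for t
  proof -
    from local[OF t(2)] obtain T x V where T: "t < T" "ereal T \<le> ?e" "is_solution f U {0..T} x" "seg x 0 = \<phi>"
      and vV: "\<And>s. s < T \<Longrightarrow> v s = V s"
      and V: "(V has_vector_derivative dir_deriv f (seg x t) (seg V t)) (at t within {0..T})"
        "has_dir_deriv (semiflow f U t) \<phi> \<phi>' (seg V t)"
      using t by (metis atLeastAtMost_iff less_imp_le)
    have sv: "seg v t = seg V t" by (rule seg_eqI) (use vV T in auto)
    have "seg (max_solution f U \<phi>) t = seg x t"
      using semiflow_eq_seg[OF f T(3) t(1) T(1)] T(4) by (simp add: semiflow_def)
    then have "(V has_vector_derivative dir_deriv f (seg (max_solution f U \<phi>) t) (seg v t)) (at t within ?I)"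
      using V(1) sv by (simp add: at_within_exit_interval[OF T(2) t(1) T(1)])
    then have "(v has_vector_derivative dir_deriv f (seg (max_solution f U \<phi>) t) (seg v t)) (at t within ?I)"
      by (rule has_vector_derivative_transform_within[where d = "T - t"])
        (use t T vV in \<open>auto simp: dist_real_def\<close>)
    then show ?thesis
      using V(2) has_dir_deriv_unique[OF V(2)] sv by (auto simp: dir_differentiable_def)
  qed
  moreover have "seg v 0 = \<phi>'"
  proof (rule seg_hist_apply)
    \<comment> \<open>At \<open>s\<close> = 0 the value of \<open>v\<close> comes from the
      derivative of the semiflow at time 0; that it fits the history \<phi>' is read off from
      \<open>V\<close>.\<close>
    from local[OF 0] show "v s = hist_apply \<phi>' s" if "s \<le> 0" for s
      using that by (metis le_less_trans)
  qed
  moreover have "continuous_on {t. ereal t < ?e} v"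
  proof (intro continuous_at_imp_continuous_on ballI)
    fix t assume "t \<in> {t. ereal t < ?e}"
    then obtain T V where T: "t < T" "continuous_on UNIV V" "\<And>s. s < T \<Longrightarrow> v s = V s"
      using local[of t] by blast
    have "continuous_on {..<T} v"
      using continuous_on_subset[OF T(2)] T(3) by (metis continuous_on_cong lessThan_iff subset_UNIV)
    then show "isCont v t"
      using T(1) by (intro continuous_on_interior[of "{..<T}"]) (auto simp: interior_open)
  qed
  ultimately show ?thesis by blast
qed

end
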